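(* There is a monotone Schauder basis $\mathcal{X}=(x_n)_{n=1}^\infty$ of a Banach space $X$ that is quasi-greedy for largest coefficients (QGLC) and democratic (hence super-democratic) but is not lower unconditional for constant coefficients (LUCC). Moreover, given $1\le p<\infty$ we can choose $\mathcal{X}$ so that its fundamental function satisfies $\varphi_u(m)\approx m^{1/p}$ for $m\in\mathbb{N}$, i.e. there is a constant $C\ge1$ with $C^{-1}m^{1/p}\le\varphi_u(m)\le Cm^{1/p}$ for all $m\in\mathbb{N}$.
   Context: $\mathbb{N}$ is the set of positive integers; the scalar field $\mathbb{F}$ is $\mathbb{R}$ or $\mathbb{C}$; $\mathbb{E}=\{\lambda\in\mathbb{F}:|\lambda|=1\}$. A basis of a Banach space $X$ is a norm-bounded sequence $(x_n)_{n=1}^\infty$ in $X$ whose linear span is dense in $X$ and for which there is a norm-bounded sequence $(x_n^* )_{n=1}^\infty$ in $X^*$ with $x_n^*(x_k)=\delta_{n,k}$. A Schauder basis of $X$ is a sequence $(x_n)$ such that every $f\in X$ has a unique norm-convergent expansion $f=\sum_na_nx_n$; the Schauder bases considered are also bases in the previous sense. For finite $A\subset\mathbb{N}$ and $\varepsilon\in\mathbb{E}^A$, $S_A(f)=\sum_{n\in A}x_n^*(f)x_n$ and $\mathbf{1}_{\varepsilon,A}=\sum_{n\in A}\varepsilon_nx_n$. A Schauder basis is monotone if $\sup_m\|S_{\{1,\dots,m\}}\|=1$. A finite set $A\subset\mathbb{N}$ is a greedy set of $f$ if $|x_n^*(f)|\ge|x_k^*(f)|$ for all $n\in A$, $k\in\mathbb{N}\setminus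 A$. For nonempty finite $A$, $\mathrm{osc}(f,A)=\max_{n\in A}|x_n^*(f)|/\min_{n\in A}|x_n^*(f)|$, with $0/0=1$ and $a/0=\infty$ for $a>0$. The basis is QGLC if there is $C$ with $\|S_A(f)\|\le C\|f\|$ for all $f\in X$ and all greedy sets $A$ of $f$ with $\mathrm{osc}(f,A)=1$; equivalently, $\|\mathbf{1}_{\varepsilon,A}\|\le C\|\mathbf{1}_{\varepsilon,A}+f\|$ for all finite $A$, all $\varepsilon\in\mathbb{E}^A$, and all $f\in X$ with $\sup_n|x_n^*(f)|\le1$ and $x_n^*(f)=0$ for $n\in A$. The basis is LUCC if there is $C$ such that $\|\sum_{n\in A}b_nx_n\|\le C\|\sum_{n\in A}a_nx_n\|$ for all finite $A$ and all scalar families such that, for every $n\in A$, $|b_n|=1$ and $a_n/b_n$ is a real number in $[1,\infty)$. The basis is super-democratic if there is $C$ such that $\|\mathbf{1}_{\varepsilon,A}\|\le C\|\mathbf{1}_{\delta,B}\|$ for all finite $A,B\subset\mathbb{N}$ with $|A|\le|B|$, all $\varepsilon\in\mathbb{E}^A$ and all $\delta\in\mathbb{E}^B$; it is democratic if this holds when $\varepsilon$ and $\delta$ are constantly $1$. The fundamental function is $\varphi_u(m)=\sup\{\|\mathbf{1}_{\varepsilon,A}\|:|A|\le m,\ \varepsilon\in\mathbb{E}^A\}$. *)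

theory Defs
  imports "HOL-Analysis.Analysis" "HOL-Library.Function_Algebras"
begin

text \<open>
  HOL cannot quantify existentially over types, so a Banach space is a subset \<open>X\<close> of an ambient
  vector space together with a norm that is meaningful on \<open>X\<close> only. The scalar field \<open>'f\<close> is
  meant to be \<^typ>\<open>real\<close> or \<^typ>\<open>complex\<close>.
\<close>

locale banach_space = vector_space scale
  for scale :: "'f::real_normed_field \<Rightarrow> 'v::ab_group_add \<Rightarrow> 'v" (infixr "*s" 75) +
  fixes X :: "'v set" and nrm :: "'v \<Rightarrow> real"
  assumes subspace_X: "subspace X"
    and nrm_nonneg: "f \<in> X \<Longrightarrow> 0 \<le> nrm f"
    and nrm_eq_0_iff: "f \<in> X \<Longrightarrow> nrm f = 0 \<longleftrightarrow> f = 0"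
    and nrm_triangle: "f \<in> X \<Longrightarrow> g \<in> X \<Longrightarrow> nrm (f + g) \<le> nrm f + nrm g"
    and nrm_scale: "f \<in> X \<Longrightarrow> nrm (a *s f) = norm a * nrm f"
    and complete: "Metric_space.mcomplete X (\<lambda>f g. nrm (f - g))"
begin

abbreviation norm_topology :: "'v topology" where
  "norm_topology \<equiv> Metric_space.mtopology X (\<lambda>f g. nrm (f - g))"

text \<open>Extended real valued, since suprema of unbounded sets of reals are unspecified.\<close>

definition operator_norm :: "('v \<Rightarrow> 'v) \<Rightarrow> ereal" where
  "operator_norm T = (SUP f\<in>{f \<in> X. nrm f \<le> 1}. ereal (nrm (T f)))"

end

text \<open>
  Indices start at \<open>0\<close>. The functional \<open>coord n\<close> is the \<open>n\<close>-th element of the dual sequence; its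
  values outside \<open>X\<close> are irrelevant.
\<close>

locale basis = banach_space scale X nrm
  for scale :: "'f::real_normed_field \<Rightarrow> 'v::ab_group_add \<Rightarrow> 'v" (infixr "*s" 75)
    and X :: "'v set" and nrm :: "'v \<Rightarrow> real" +
  fixes x :: "nat \<Rightarrow> 'v" and coord :: "nat \<Rightarrow> 'v \<Rightarrow> 'f"
  assumes x_in_X: "x n \<in> X"
    and x_bounded: "\<exists>K. \<forall>n. nrm (x n) \<le> K"
    and x_dense: "norm_topology closure_of (span (range x)) = X"
    and coord_add: "f \<in> X \<Longrightarrow> g \<in> X \<Longrightarrow> coord n (f + g) = coord n f + coord n g"
    and coord_scale: "f \<in> X \<Longrightarrow> coord n (a *s f) = a * coord n f"
    and coord_bounded: "\<exists>K. \<forall>n. \<forall>f\<in>X. norm (coord n f) \<le> K * nrm f"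
    and coord_x: "coord n (x k) = (if n = k then 1 else 0)"
begin

definition coord_projection :: "nat set \<Rightarrow> 'v \<Rightarrow> 'v" where
  "coord_projection A f = (\<Sum>n\<in>A. coord n f *s x n)"

definition indicator_sum :: "(nat \<Rightarrow> 'f) \<Rightarrow> nat set \<Rightarrow> 'v" where
  "indicator_sum \<epsilon> A = (\<Sum>n\<in>A. \<epsilon> n *s x n)"

definition unimodular_on :: "nat set \<Rightarrow> (nat \<Rightarrow> 'f) \<Rightarrow> bool" where
  "unimodular_on A \<epsilon> \<longleftrightarrow> (\<forall>n\<in>A. norm (\<epsilon> n) = 1)"

text \<open>The sets \<open>{..m}\<close> are the nonempty initial segments of the index set.\<close>

definition monotone_basis :: bool where
  "monotone_basis \<longleftrightarrow> (SUP m. operator_norm (coord_projection {..m})) = 1"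

definition greedy_set :: "'v \<Rightarrow> nat set \<Rightarrow> bool" where
  "greedy_set f A \<longleftrightarrow>
     finite A \<and> (\<forall>n\<in>A. \<forall>k\<in>- A. norm (coord n f) \<ge> norm (coord k f))"

text \<open>Only meaningful for finite nonempty \<open>A\<close>.\<close>

definition oscillation :: "'v \<Rightarrow> nat set \<Rightarrow> ereal" where
  "oscillation f A =
     (let M = Max ((\<lambda>n. norm (coord n f)) ` A);
          m = Min ((\<lambda>n. norm (coord n f)) ` A)
      in if m = 0 then (if M = 0 then 1 else \<infinity>) else ereal (M / m))"

definition qglc :: bool where
  "qglc \<longleftrightarrow> (\<exists>C. \<forall>f\<in>X. \<forall>A. greedy_set f A \<and> A \<noteq> {} \<and> oscillation f A = 1 \<longrightarrow>
     nrm (coord_projection A f) \<le> C * nrm f)"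

definition lucc :: bool where
  "lucc \<longleftrightarrow> (\<exists>C. \<forall>A a b. finite A \<and> unimodular_on A b \<and>
       (\<forall>n\<in>A. \<exists>t\<ge>1. a n / b n = of_real t) \<longrightarrow>
     nrm (\<Sum>n\<in>A. b n *s x n) \<le> C * nrm (\<Sum>n\<in>A. a n *s x n))"

definition super_democratic :: bool where
  "super_democratic \<longleftrightarrow> (\<exists>C. \<forall>A B \<epsilon> \<delta>. finite A \<and> finite B \<and> card A \<le> card B \<and>
       unimodular_on A \<epsilon> \<and> unimodular_on B \<delta> \<longrightarrow>
     nrm (indicator_sum \<epsilon> A) \<le> C * nrm (indicator_sum \<delta> B))"

definition democratic :: bool where
  "democratic \<longleftrightarrow> (\<exists>C. \<forall>A B. finite A \<and> finite B \<and> card A \<le> card B \<longrightarrow>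
     nrm (indicator_sum (\<lambda>_. 1) A) \<le> C * nrm (indicator_sum (\<lambda>_. 1) B))"

definition fundamental_values :: "nat \<Rightarrow> real set" where
  "fundamental_values m =
     {nrm (indicator_sum \<epsilon> A) |\<epsilon> A. finite A \<and> card A \<le> m \<and> unimodular_on A \<epsilon>}"

definition fundamental_function :: "nat \<Rightarrow> real" where
  "fundamental_function m = Sup (fundamental_values m)"

lemma indicator_sum_in_X: "indicator_sum \<epsilon> A \<in> X"
  unfolding indicator_sum_def
  by (intro subspace_sum subspace_scale subspace_X x_in_X)

lemma nrm_indicator_sum_le:
  assumes "finite A" "unimodular_on A \<epsilon>" "\<And>n. nrm (x n) \<le> K"
  shows "nrm (indicator_sum \<epsilon> A) \<le> real (card A) * K"
  using assms(1,2)
proof (induction A rule: finite_induct)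
  case empty
  show ?case
    using nrm_eq_0_iff[OF subspace_0[OF subspace_X]] by (simp add: indicator_sum_def)
next
  case (insert n A)
  have "nrm (indicator_sum \<epsilon> (insert n A)) = nrm (\<epsilon> n *s x n + indicator_sum \<epsilon> A)"
    using insert.hyps by (simp add: indicator_sum_def)
  also have "\<dots> \<le> nrm (\<epsilon> n *s x n) + nrm (indicator_sum \<epsilon> A)"
    by (intro nrm_triangle indicator_sum_in_X subspace_scale[OF subspace_X] x_in_X)
  also have "\<dots> \<le> K + real (card A) * K"
    using insert assms(3)[of n] by (auto simp: nrm_scale x_in_X unimodular_on_def)
  finally show ?case
    using insert.hyps by (simp add: algebra_simps)
qed

lemma fundamental_values_nonempty: "fundamental_values m \<noteq> {}"
  unfolding fundamental_values_def unimodular_on_def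
  by (auto intro!: exI[of _ "{}"])

lemma bdd_above_fundamental_values: "bdd_above (fundamental_values m)"
proof -
  obtain K where K: "\<And>n. nrm (x n) \<le> K"
    using x_bounded by blast
  have "0 \<le> K"
    using K[of 0] nrm_nonneg[OF x_in_X[of 0]] by linarith
  then have "v \<le> real m * K" if "v \<in> fundamental_values m" for v
    using that nrm_indicator_sum_le[OF _ _ K] unfolding fundamental_values_def
    by (force intro: order_trans mult_right_mono)
  then show ?thesis
    by (rule bdd_aboveI)
qed

end

locale schauder_basis = basis +
  assumes unique_expansion:
    "f \<in> X \<Longrightarrow> \<exists>!a. limitin norm_topology (\<lambda>m. \<Sum>n<m. a n *s x n) f sequentially"

text \<open>
  The ambient space of scalar sequences. A Schauder basis identifies its Banach space with a
  space of scalar sequences, so this choice of ambient space costs no generality.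
\<close>

definition seq_scale :: "'f::real_normed_field \<Rightarrow> (nat \<Rightarrow> 'f) \<Rightarrow> nat \<Rightarrow> 'f" where
  "seq_scale c f = (\<lambda>n. c * f n)"

lemma vector_space_seq_scale: "vector_space seq_scale"
  by unfold_locales (auto simp: seq_scale_def algebra_simps fun_eq_iff)

end

theory Submission
  imports Defs
begin

text \<open>
  The norm is the supremum of \<open>\<bar>\<Sum>n<m. h n * f n\<bar>\<close> over all \<open>m\<close> and over a set of functionals \<open>h\<close>
  cut out by two conditions. The first, \<open>\<Sum>n\<in>B. \<bar>h n\<bar> \<le> card B powr (1 / p)\<close>, bounds indicator sums
  from above. The second, that the partial sums of \<open>h\<close> against a weight \<open>w\<^sub>k\<close> on the \<open>k\<close>-th block
  of indices stay below \<open>1\<close>, makes \<open>w\<^sub>k\<close> a vector of norm at most \<open>1\<close>.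

  The block is \<open>{b ^ k..<2 * b ^ k}\<close>, a \<open>b\<close>-ary tree of depth \<open>k\<close> in preorder: the level of an index
  is \<open>k\<close> minus the multiplicity of \<open>b\<close> in it, and level \<open>j\<close> has weight \<open>q powr - j\<close> with
  \<open>2 * q = b powr (1 / p)\<close>. As \<open>w\<^sub>k\<close> is at least \<open>q powr - k\<close> everywhere while the indicator of the block
  has norm about \<open>(2 * q) ^ k\<close>, the LUCC constant is at least of order \<open>2 ^ k\<close>.

  On the other hand, if \<open>\<bar>f\<bar> \<le> 1\<close> with equality on \<open>A\<close>, then \<open>f\<close> has norm at least of order
  \<open>card A powr (1 / p)\<close>. A multiple of \<open>1 / f\<close> on \<open>A\<close> is a suitable functional once its partial sums
  against \<open>w\<^sub>k\<close> are under control: there is one critical level such that at least half of \<open>A\<close> lies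
  on it or below it; the levels below carry a negligible weight, and the contribution of
  the critical level is cancelled at the parents, which are so heavy that little mass is needed there.
\<close>

section \<open>Schauder bases from norming sets\<close>

definition unit_seq :: "nat \<Rightarrow> nat \<Rightarrow> 'f::real_normed_field" where
  "unit_seq n = (\<lambda>k. if k = n then 1 else 0)"

definition trunc :: "nat \<Rightarrow> (nat \<Rightarrow> 'f::real_normed_field) \<Rightarrow> nat \<Rightarrow> 'f" where
  "trunc m f = (\<lambda>n. if n < m then f n else 0)"

definition pairing :: "nat \<Rightarrow> (nat \<Rightarrow> 'f::real_normed_field) \<Rightarrow> (nat \<Rightarrow> 'f) \<Rightarrow> 'f" where
  "pairing m h f = (\<Sum>n<m. h n * f n)"

lemma pairing_add: "pairing m h (f + g) = pairing m h f + pairing m h g"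
  by (simp add: pairing_def algebra_simps sum.distrib)

lemma pairing_diff: "pairing m h (f - g) = pairing m h f - pairing m h g"
  by (simp add: pairing_def algebra_simps sum_subtractf)

lemma pairing_scale: "pairing m h (seq_scale c f) = c * pairing m h f"
  by (simp add: pairing_def seq_scale_def sum_distrib_left algebra_simps)

lemma pairing_trunc: "pairing m h (trunc k f) = pairing (min m k) h f"
proof -
  have "pairing m h (trunc k f) = (\<Sum>n<m. if n \<in> {..<k} then h n * f n else 0)"
    by (simp add: pairing_def trunc_def if_distrib cong: if_cong)
  also have "\<dots> = (\<Sum>n\<in>{..<m} \<inter> {..<k}. h n * f n)"
    by (subst sum.inter_restrict) auto
  also have "{..<m} \<inter> {..<k} = {..<min m k}"
    by auto
  finally show ?thesis
    by (simp add: pairing_def)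
qed

lemma pairing_unit_seq: "pairing m (unit_seq n) f = (if n < m then f n else 0)"
proof -
  have "pairing m (unit_seq n) f = (\<Sum>k<m. if k = n then f k else 0)"
    unfolding pairing_def unit_seq_def by (rule sum.cong) auto
  then show ?thesis
    by simp
qed

lemma pairing_unit_seq_right: "pairing m h (unit_seq n) = (if n < m then h n else 0)"
  using pairing_unit_seq[of m n h] by (simp add: pairing_def mult.commute)

lemma pairing_seq_sum:
  assumes "finite A"
  shows "pairing m h (\<lambda>n. if n \<in> A then a n else 0) = (\<Sum>n\<in>A \<inter> {..<m}. h n * a n)"
proof -
  have "pairing m h (\<lambda>n. if n \<in> A then a n else 0) = (\<Sum>n<m. if n \<in> A then h n * a n else 0)"
    by (simp add: pairing_def if_distrib cong: if_cong)
  also have "\<dots> = (\<Sum>n\<in>{..<m} \<inter> A. h n * a n)"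
    by (subst sum.inter_restrict) auto
  finally show ?thesis
    by (simp add: Int_commute)
qed

lemma sum_fun_apply: "(\<Sum>n\<in>A. f n) k = (\<Sum>n\<in>A. f n k)"
  by (induction A rule: infinite_finite_induct) auto

lemma sum_scale_unit_seq:
  assumes "finite A"
  shows "(\<Sum>n\<in>A. seq_scale (a n) (unit_seq n)) = (\<lambda>n. if n \<in> A then a n else 0)"
proof
  fix k
  have "(\<Sum>n\<in>A. seq_scale (a n) (unit_seq n)) k = (\<Sum>n\<in>A. if n = k then a n else 0)"
    unfolding sum_fun_apply seq_scale_def unit_seq_def by (rule sum.cong) auto
  also have "\<dots> = (if k \<in> A then a k else 0)"
    using assms by simp
  finally show "(\<Sum>n\<in>A. seq_scale (a n) (unit_seq n)) k = (if k \<in> A then a k else 0)" .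
qed

lemma sum_scale_unit_seq_lessThan:
  "(\<Sum>n<m. seq_scale (f n) (unit_seq n)) = trunc m f"
  by (simp add: sum_scale_unit_seq trunc_def)

section \<open>The Banach space normed by a set of functionals\<close>

locale norming_set =
  fixes H :: "(nat \<Rightarrow> 'f::{real_normed_field,banach}) set"
  assumes norming_le: "h \<in> H \<Longrightarrow> norm (h n) \<le> 1"
    and norming_unit: "unit_seq n \<in> H"
begin

text \<open>All partial sums are tested, not only the full series, so truncation cannot increase the
  norm; this is what makes the basis monotone.\<close>

definition bounds :: "(nat \<Rightarrow> 'f) \<Rightarrow> real \<Rightarrow> bool" where
  "bounds f C \<longleftrightarrow> (\<forall>h\<in>H. \<forall>m. norm (pairing m h f) \<le> C)"

text \<open>The value \<open>0\<close> for unbounded arguments keeps \<open>nrm (f - g)\<close> nonnegative and symmetric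
  everywhere, as the metric space locale demands.\<close>

definition nrm :: "(nat \<Rightarrow> 'f) \<Rightarrow> real" where
  "nrm f = (if \<exists>C. bounds f C then SUP (h, m)\<in>H \<times> UNIV. norm (pairing m h f) else 0)"

text \<open>The second condition singles out the closed span of the unit vectors: a sequence that is
  merely bounded against \<open>H\<close> may have truncations that do not converge to it.\<close>

definition X :: "(nat \<Rightarrow> 'f) set" where
  "X = {f. (\<exists>C. bounds f C) \<and> (\<lambda>m. nrm (f - trunc m f)) \<longlonglongrightarrow> 0}"

lemma pairing_le_nrm:
  assumes "bounds f C" "h \<in> H"
  shows "norm (pairing m h f) \<le> nrm f"
proof -
  have "norm (pairing m h f) \<le> (SUP (h, m)\<in>H \<times> UNIV. norm (pairing m h f))"
    using assms
    by (intro cSUP_upper2[where x = "(h, m)"] bdd_aboveI2[where M = C]) (auto simp: bounds_def)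
  then show ?thesis
    using assms by (auto simp: nrm_def)
qed

lemma nrm_le: "bounds f C \<Longrightarrow> nrm f \<le> C"
  using norming_unit unfolding nrm_def by (auto intro!: cSUP_least) (auto simp: bounds_def)

lemma bounds_nrm: "bounds f C \<Longrightarrow> bounds f (nrm f)"
  using pairing_le_nrm by (auto simp: bounds_def)

lemma nrm_ge_0: "0 \<le> nrm f"
proof (cases "\<exists>C. bounds f C")
  case True
  then show ?thesis
    using pairing_le_nrm[OF _ norming_unit] norm_ge_zero order_trans by blast
qed (simp add: nrm_def)

lemma bounds_add: "bounds f C \<Longrightarrow> bounds g D \<Longrightarrow> bounds (f + g) (C + D)"
  by (auto simp: bounds_def pairing_add intro!: norm_triangle_mono)

lemma bounds_diff: "bounds f C \<Longrightarrow> bounds g D \<Longrightarrow> bounds (f - g) (C + D)"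
  by (auto simp: bounds_def pairing_diff intro!: norm_triangle_le_diff add_mono)

lemma bounds_scale: "bounds f C \<Longrightarrow> bounds (seq_scale c f) (norm c * C)"
  by (auto simp: bounds_def pairing_scale norm_mult intro!: mult_left_mono)

lemma bounds_trunc: "bounds f C \<Longrightarrow> bounds (trunc k f) C"
  by (auto simp: bounds_def pairing_trunc)

text \<open>The functional \<open>unit_seq n\<close> lies in \<open>H\<close> and reads off a
  coordinate. Contractive coordinates yield definiteness of the norm, coordinatewise limits and
  uniqueness of expansions.\<close>

lemma norm_nth_le: "bounds f C \<Longrightarrow> norm (f n) \<le> nrm f"
  using pairing_le_nrm[OF _ norming_unit, of f C "Suc n" n] by (simp add: pairing_unit_seq)

lemma nrm_commute: "nrm (f - g) = nrm (g - f)"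
proof -
  have "pairing m h (f - g) = - pairing m h (g - f)" for m h
    by (simp add: pairing_diff)
  then have "norm (pairing m h (f - g)) = norm (pairing m h (g - f))" for m h
    by simp
  then show ?thesis
    by (simp only: nrm_def bounds_def)
qed

lemma nrm_add: "bounds f C \<Longrightarrow> bounds g D \<Longrightarrow> nrm (f + g) \<le> nrm f + nrm g"
  by (meson nrm_le bounds_add bounds_nrm)

lemma nrm_seq_scale:
  assumes "bounds f C"
  shows "nrm (seq_scale c f) = norm c * nrm f"
proof (rule antisym)
  show le: "nrm (seq_scale c f) \<le> norm c * nrm f"
    by (meson assms nrm_le bounds_scale bounds_nrm)
  show "norm c * nrm f \<le> nrm (seq_scale c f)"
  proof (cases "c = 0")
    case False
    have "bounds f (nrm (seq_scale c f) / norm c)"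
      using bounds_nrm[OF bounds_scale[OF assms, of c]] False
      by (auto simp: bounds_def pairing_scale norm_mult field_simps)
    then show ?thesis
      using nrm_le False by (force simp: field_simps)
  qed (use nrm_ge_0 in auto)
qed

lemma nrm_trunc: "bounds f C \<Longrightarrow> nrm (trunc k f) \<le> nrm f"
  by (meson nrm_le bounds_trunc bounds_nrm)

lemma nrm_zero: "nrm 0 = 0"
  using nrm_le[of 0 0] nrm_ge_0[of 0] by (simp add: bounds_def pairing_def)

lemma bounds_X: "f \<in> X \<Longrightarrow> bounds f (nrm f)"
  using bounds_nrm by (auto simp: X_def)

lemma finite_support_X:
  assumes "\<And>n. n \<ge> N \<Longrightarrow> f n = 0"
  shows "f \<in> X"
proof -
  have tail: "pairing m h f = pairing (min m N) h f" for m h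
    unfolding pairing_def using assms by (intro sum.mono_neutral_right) auto
  \<comment> \<open>The l_1 norm is a crude bound, available because members of \<open>H\<close>
    have entries of modulus at most \<open>1\<close>.\<close>
  have "bounds f (\<Sum>n<N. norm (f n))"
    unfolding bounds_def
  proof (intro ballI allI)
    fix h m assume h: "h \<in> H"
    have "norm (pairing m h f) \<le> (\<Sum>n<min m N. norm (h n * f n))"
      unfolding tail[of m] unfolding pairing_def by (rule norm_sum)
    also have "\<dots> \<le> (\<Sum>n<N. norm (h n * f n))"
      by (rule sum_mono2) auto
    also have "\<dots> \<le> (\<Sum>n<N. norm (f n))"
      using norming_le[OF h] by (intro sum_mono) (simp add: norm_mult mult_left_le_one_le)
    finally show "norm (pairing m h f) \<le> (\<Sum>n<N. norm (f n))" .
  qed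
  moreover have "f - trunc m f = 0" if "m \<ge> N" for m
    using that assms by (auto simp: trunc_def fun_eq_iff)
  then have "(\<lambda>m. nrm (f - trunc m f)) \<longlonglongrightarrow> 0"
    by (intro tendsto_eventually) (auto simp: eventually_sequentially nrm_zero intro!: exI[of _ N])
  ultimately show ?thesis
    by (auto simp: X_def)
qed

lemma trunc_X: "trunc m f \<in> X"
  by (rule finite_support_X[of m]) (simp add: trunc_def)

lemma finite_sum_X: "finite A \<Longrightarrow> (\<lambda>n. if n \<in> A then a n else 0) \<in> X"
  by (rule finite_support_X[of "Suc (Max A)"]) (auto simp: Suc_le_eq dest: Max_ge)

lemma X_add:
  assumes "f \<in> X" "g \<in> X"
  shows "f + g \<in> X"
proof -
  have tail: "bounds (f - trunc m f) (nrm f + nrm f)" if "f \<in> X" for f m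
    by (intro bounds_diff bounds_trunc bounds_X that)
  have split: "f + g - trunc m (f + g) = (f - trunc m f) + (g - trunc m g)" for m
    by (auto simp: trunc_def fun_eq_iff)
  have "(\<lambda>m. nrm (f + g - trunc m (f + g))) \<longlonglongrightarrow> 0"
  proof (rule tendsto_sandwich)
    show "\<forall>\<^sub>F m in sequentially. 0 \<le> nrm (f + g - trunc m (f + g))"
      by (simp add: nrm_ge_0)
    show "\<forall>\<^sub>F m in sequentially.
        nrm (f + g - trunc m (f + g)) \<le> nrm (f - trunc m f) + nrm (g - trunc m g)"
      unfolding split by (intro always_eventually allI nrm_add[OF tail tail] assms)
    show "(\<lambda>m. nrm (f - trunc m f) + nrm (g - trunc m g)) \<longlonglongrightarrow> 0"
      using assms unfolding X_def by (intro tendsto_add_zero) simp_all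
  qed simp
  moreover have "\<exists>C. bounds (f + g) C"
    using bounds_add[OF bounds_X[OF assms(1)] bounds_X[OF assms(2)]] by (rule exI)
  ultimately show ?thesis
    by (simp add: X_def)
qed

lemma X_scale:
  assumes "f \<in> X"
  shows "seq_scale c f \<in> X"
proof -
  have tail: "bounds (f - trunc m f) (nrm f + nrm f)" if "f \<in> X" for f m
    by (intro bounds_diff bounds_trunc bounds_X that)
  have scale: "seq_scale c f - trunc m (seq_scale c f) = seq_scale c (f - trunc m f)" for m
    by (auto simp: trunc_def seq_scale_def fun_eq_iff algebra_simps)
  have "(\<lambda>m. nrm (seq_scale c f - trunc m (seq_scale c f))) \<longlonglongrightarrow> 0"
    unfolding scale nrm_seq_scale[OF tail[OF assms]]
    using assms unfolding X_def by (intro tendsto_mult_right_zero) simp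
  moreover have "\<exists>C. bounds (seq_scale c f) C"
    using bounds_scale[OF bounds_X[OF assms]] by (rule exI)
  ultimately show ?thesis
    by (simp add: X_def)
qed

lemma X_diff: "f \<in> X \<Longrightarrow> g \<in> X \<Longrightarrow> f - g \<in> X"
proof -
  assume "f \<in> X" "g \<in> X"
  then have "f + seq_scale (- 1) g \<in> X"
    by (intro X_add X_scale)
  also have "f + seq_scale (- 1) g = f - g"
    by (auto simp: seq_scale_def fun_eq_iff)
  finally show ?thesis .
qed

lemma nrm_eq_0:
  assumes "f \<in> X"
  shows "nrm f = 0 \<longleftrightarrow> f = 0"
proof
  assume "nrm f = 0"
  then have "f n = 0" for n
    using norm_nth_le[OF bounds_X[OF assms], of n] by simp
  then show "f = 0"
    by (simp add: fun_eq_iff)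
qed (simp add: nrm_zero)

section \<open>Metric structure and completeness\<close>

lemma Metric_space_X: "Metric_space X (\<lambda>f g. nrm (f - g))"
proof
  show "nrm (f - h) \<le> nrm (f - g) + nrm (g - h)" if "f \<in> X" "g \<in> X" "h \<in> X" for f g h
    using nrm_add[OF bounds_X[OF X_diff[OF that(1,2)]] bounds_X[OF X_diff[OF that(2,3)]]] by simp
  show "nrm (f - g) = 0 \<longleftrightarrow> f = g" if "f \<in> X" "g \<in> X" for f g
    using nrm_eq_0[OF X_diff[OF that]] by simp
  show "nrm (f - g) = nrm (g - f)" for f g
    by (rule nrm_commute)
qed (rule nrm_ge_0)

sublocale M: Metric_space X "\<lambda>f g. nrm (f - g)"
  by (rule Metric_space_X)

text \<open>Each pairing involves finitely many coordinates, so a Cauchy estimate passes to the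
  coordinatewise limit with the same constant, uniformly in \<open>h\<close> and
  \<open>m\<close>.\<close>

lemma mcomplete_X: "M.mcomplete"
  unfolding M.mcomplete_def
proof (intro allI impI)
  fix \<sigma> :: "nat \<Rightarrow> nat \<Rightarrow> 'f" assume "M.MCauchy \<sigma>"
  then have \<sigma>X: "\<And>i. \<sigma> i \<in> X"
    and cauchy: "\<And>e. e > 0 \<Longrightarrow> \<exists>N. \<forall>i j. N \<le> i \<longrightarrow> N \<le> j \<longrightarrow> nrm (\<sigma> i - \<sigma> j) < e"
    unfolding M.MCauchy_def by blast+
  have coord: "norm (\<sigma> i n - \<sigma> j n) \<le> nrm (\<sigma> i - \<sigma> j)" for i j n
    using norm_nth_le[OF bounds_X[OF X_diff[OF \<sigma>X \<sigma>X]]] by simp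
  have "Cauchy (\<lambda>i. \<sigma> i n)" for n
  proof (rule CauchyI)
    fix e :: real assume "0 < e"
    then obtain N where "\<And>i j. N \<le> i \<Longrightarrow> N \<le> j \<Longrightarrow> nrm (\<sigma> i - \<sigma> j) < e"
      using cauchy by blast
    then show "\<exists>M. \<forall>i\<ge>M. \<forall>j\<ge>M. norm (\<sigma> i n - \<sigma> j n) < e"
      by (intro exI[of _ N] allI impI le_less_trans[OF coord])
  qed
  then have "convergent (\<lambda>i. \<sigma> i n)" for n
    by (rule Cauchy_convergent)
  then have lim: "(\<lambda>i. \<sigma> i n) \<longlonglongrightarrow> lim (\<lambda>i. \<sigma> i n)" for n
    by (simp add: convergent_LIMSEQ_iff)
  define f where "f = (\<lambda>n. lim (\<lambda>i. \<sigma> i n))"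
  have f: "(\<lambda>i. \<sigma> i n) \<longlonglongrightarrow> f n" for n
    unfolding f_def by (rule lim)
  have close: "\<exists>N. \<forall>i\<ge>N. bounds (\<sigma> i - f) e" if e: "e > 0" for e
  proof -
    obtain N where N: "\<And>i j. N \<le> i \<Longrightarrow> N \<le> j \<Longrightarrow> nrm (\<sigma> i - \<sigma> j) < e"
      using cauchy[OF e] by blast
    have "norm (pairing m h (\<sigma> i - f)) \<le> e" if "i \<ge> N" "h \<in> H" for i h m
    proof (rule tendsto_upperbound)
      show "(\<lambda>j. norm (pairing m h (\<sigma> i - \<sigma> j))) \<longlonglongrightarrow> norm (pairing m h (\<sigma> i - f))"
        unfolding pairing_def minus_apply by (intro tendsto_intros f)
      show "\<forall>\<^sub>F j in sequentially. norm (pairing m h (\<sigma> i - \<sigma> j)) \<le> e"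
        using N[OF \<open>i \<ge> N\<close>]
        by (intro eventually_sequentiallyI[of N]
            order_trans[OF pairing_le_nrm[OF bounds_X[OF X_diff[OF \<sigma>X \<sigma>X]] \<open>h \<in> H\<close>]])
          (simp add: less_imp_le)
    qed simp
    then show ?thesis
      by (auto simp: bounds_def)
  qed
  have bnd: "\<exists>C. bounds f C"
  proof -
    obtain i where "bounds (\<sigma> i - f) 1"
      using close[of 1] by auto
    then have "bounds (\<sigma> i - (\<sigma> i - f)) (nrm (\<sigma> i) + 1)"
      by (intro bounds_diff bounds_X \<sigma>X)
    then show ?thesis
      by auto
  qed
  have "(\<lambda>m. nrm (f - trunc m f)) \<longlonglongrightarrow> 0"
  proof (rule LIMSEQ_I)
    fix e :: real assume e: "0 < e"
    obtain i where i: "bounds (\<sigma> i - f) (e / 4)"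
      using close[of "e / 4"] e by auto
    have "(\<lambda>m. nrm (\<sigma> i - trunc m (\<sigma> i))) \<longlonglongrightarrow> 0"
      using \<sigma>X[of i] by (auto simp: X_def)
    then have "\<exists>N. \<forall>m\<ge>N. norm (nrm (\<sigma> i - trunc m (\<sigma> i)) - 0) < e / 4"
      using e by (intro LIMSEQ_D) auto
    then obtain N where N: "\<And>m. m \<ge> N \<Longrightarrow> nrm (\<sigma> i - trunc m (\<sigma> i)) < e / 4"
      by (auto simp: nrm_ge_0)
    have "nrm (f - trunc m f) < e" if "m \<ge> N" for m
    proof -
      have "bounds (\<sigma> i - trunc m (\<sigma> i)) (e / 4)"
        unfolding bounds_def
        using order_trans[OF pairing_le_nrm[OF bounds_X[OF X_diff[OF \<sigma>X trunc_X]]] less_imp_le[OF N[OF that]]]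
        by blast
      \<comment> \<open>The tail of \<open>f\<close> is the tail of \<open>\<sigma> i\<close> minus
        the tail of the error \<open>\<sigma> i - f\<close>. The latter costs \<open>e / 4\<close>
        twice, which leaves \<open>3 * e / 4 < e\<close> in total.\<close>
      then have "bounds ((\<sigma> i - trunc m (\<sigma> i)) - ((\<sigma> i - f) - trunc m (\<sigma> i - f))) (e / 4 + (e / 4 + e / 4))"
        by (intro bounds_diff bounds_trunc i)
      also have "(\<sigma> i - trunc m (\<sigma> i)) - ((\<sigma> i - f) - trunc m (\<sigma> i - f)) = f - trunc m f"
        by (auto simp: trunc_def fun_eq_iff)
      finally show ?thesis
        using nrm_le[of "f - trunc m f"] e by fastforce
    qed
    then show "\<exists>no. \<forall>m\<ge>no. norm (nrm (f - trunc m f) - 0) < e"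
      using nrm_ge_0 by auto
  qed
  with bnd have fX: "f \<in> X"
    by (simp add: X_def)
  have "\<exists>N. \<forall>i\<ge>N. nrm (\<sigma> i - f) < e" if e: "e > 0" for e
  proof -
    obtain N where "\<forall>i\<ge>N. bounds (\<sigma> i - f) (e / 2)"
      using close[of "e / 2"] e by auto
    then have "\<forall>i\<ge>N. nrm (\<sigma> i - f) \<le> e / 2"
      using nrm_le by blast
    then show ?thesis
      using e by (intro exI[of _ N]) fastforce
  qed
  then show "\<exists>f. limitin M.mtopology \<sigma> f sequentially"
    unfolding M.limit_metric_sequentially using fX \<sigma>X by (intro exI[of _ f]) simp
qed

lemma banach_space_X: "banach_space seq_scale X nrm"
proof -
  interpret vector_space "seq_scale :: 'f \<Rightarrow> _"
    by (rule vector_space_seq_scale)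
  show ?thesis
  proof (intro banach_space.intro banach_space_axioms.intro vector_space_seq_scale mcomplete_X)
    show "subspace X"
      unfolding subspace_def
      using X_add X_scale finite_support_X[of 0 0] by auto
    show "nrm (f + g) \<le> nrm f + nrm g" if "f \<in> X" "g \<in> X" for f g
      by (rule nrm_add[OF bounds_X[OF that(1)] bounds_X[OF that(2)]])
    show "nrm (seq_scale a f) = norm a * nrm f" if "f \<in> X" for f a
      by (rule nrm_seq_scale[OF bounds_X[OF that]])
    show "0 \<le> nrm f" for f
      by (rule nrm_ge_0)
    show "nrm f = 0 \<longleftrightarrow> f = 0" if "f \<in> X" for f
      by (rule nrm_eq_0[OF that])
  qed
qed

sublocale B: banach_space seq_scale X nrm
  by (rule banach_space_X)

section \<open>The unit vectors as a monotone Schauder basis\<close>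

lemma limitin_trunc:
  assumes "f \<in> X"
  shows "limitin M.mtopology (\<lambda>m. trunc m f) f sequentially"
proof -
  have "(\<lambda>m. nrm (trunc m f - f)) \<longlonglongrightarrow> 0"
    using assms unfolding X_def nrm_commute[of "trunc _ f"] by simp
  then show ?thesis
    unfolding M.limitin_metric_dist_null using assms trunc_X by simp
qed

lemma nrm_unit_seq_le: "nrm (unit_seq n) \<le> 1"
proof (rule nrm_le)
  show "bounds (unit_seq n) 1"
    using norming_le by (simp add: bounds_def pairing_unit_seq_right)
qed

lemma unit_seq_X: "unit_seq n \<in> X"
  by (rule finite_support_X[of "Suc n"]) (simp add: unit_seq_def)

lemma basis_X: "basis seq_scale X nrm unit_seq (\<lambda>n f. f n)"
proof (intro basis.intro basis_axioms.intro banach_space_X)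
  show "\<exists>K. \<forall>n. nrm (unit_seq n) \<le> K"
    using nrm_unit_seq_le by blast
  show "M.mtopology closure_of B.span (range unit_seq) = X"
  proof
    show "X \<subseteq> M.mtopology closure_of B.span (range unit_seq)"
    proof
      fix f assume f: "f \<in> X"
      have "trunc m f \<in> B.span (range unit_seq)" for m
        unfolding sum_scale_unit_seq_lessThan[symmetric]
        by (intro B.span_sum B.span_scale B.span_base) auto
      moreover have "\<exists>m. trunc m f \<in> M.mball f r" if "r > 0" for r
        using limitin_trunc[OF f] that f unfolding M.limit_metric_sequentially
        by (simp add: nrm_commute[of f]) blast
      ultimately show "f \<in> M.mtopology closure_of B.span (range unit_seq)"
        unfolding M.metric_closure_of using f by simp blast
    qed
  qed (metis closure_of_subset_topspace M.topspace_mtopology)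
  show "\<exists>K. \<forall>n. \<forall>f\<in>X. norm (f n) \<le> K * nrm f"
    using norm_nth_le[OF bounds_X] by (intro exI[of _ 1]) simp
  show "unit_seq n \<in> X" for n
    by (rule unit_seq_X)
qed (auto simp: seq_scale_def unit_seq_def)

sublocale B: basis seq_scale X nrm unit_seq "\<lambda>n f. f n"
  by (rule basis_X)

lemma schauder_basis_X: "schauder_basis seq_scale X nrm unit_seq (\<lambda>n f. f n)"
proof (intro schauder_basis.intro schauder_basis_axioms.intro basis_X)
  fix f assume f: "f \<in> X"
  have "a = f" if lim: "limitin M.mtopology (\<lambda>m. \<Sum>n<m. seq_scale (a n) (unit_seq n)) f sequentially" for a
  proof
    fix n
    have lim0: "(\<lambda>m. nrm (trunc m a - f)) \<longlonglongrightarrow> 0"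
      using lim by (simp add: sum_scale_unit_seq_lessThan M.limitin_metric_dist_null)
    \<comment> \<open>Once \<open>m > n\<close>, the \<open>n\<close>-th coordinate of the partial
      sum is frozen at \<open>a n\<close>, so convergence forces it to equal
      \<open>f n\<close>.\<close>
    have "norm (a n - f n) \<le> nrm (trunc m a - f)" if "m > n" for m
      using norm_nth_le[OF bounds_X[OF X_diff[OF trunc_X f]], of m a n] that
      by (simp add: trunc_def)
    then have "norm (a n - f n) \<le> 0"
      by (intro tendsto_lowerbound[OF lim0]) (auto simp: eventually_sequentially intro!: exI[of _ "Suc n"])
    then show "a n = f n"
      by simp
  qed
  then show "\<exists>!a. limitin M.mtopology (\<lambda>m. \<Sum>n<m. seq_scale (a n) (unit_seq n)) f sequentially"
    using limitin_trunc[OF f] by (intro ex1I[of _ f]) (auto simp: sum_scale_unit_seq_lessThan)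
qed

lemma coord_projection_eq:
  "finite A \<Longrightarrow> B.coord_projection A f = (\<lambda>n. if n \<in> A then f n else 0)"
  by (simp add: B.coord_projection_def sum_scale_unit_seq)

lemma indicator_sum_eq:
  "finite A \<Longrightarrow> B.indicator_sum \<epsilon> A = (\<lambda>n. if n \<in> A then \<epsilon> n else 0)"
  by (simp add: B.indicator_sum_def sum_scale_unit_seq)

lemma nrm_unit_seq: "nrm (unit_seq n) = 1"
  using norm_nth_le[OF bounds_X[OF unit_seq_X], of n n] nrm_unit_seq_le[of n]
  by (simp add: unit_seq_def)

lemma monotone_basis_X: "B.monotone_basis"
proof -
  \<comment> \<open>The set \<open>{..m}\<close> contains \<open>m\<close>, hence
    \<open>Suc m\<close>. The operator norm \<open>1\<close> is attained at
    \<open>unit_seq 0\<close>, which all these projections fix.\<close>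
  have proj: "B.coord_projection {..m} f = trunc (Suc m) f" for m f
    by (auto simp: coord_projection_eq trunc_def)
  have "B.operator_norm (B.coord_projection {..m}) = 1" for m
  proof (rule antisym)
    show "B.operator_norm (B.coord_projection {..m}) \<le> 1"
      unfolding B.operator_norm_def proj
      using nrm_trunc[OF bounds_X] by (intro SUP_least) (force intro: order_trans)
    have "trunc (Suc m) (unit_seq 0) = (unit_seq 0 :: nat \<Rightarrow> 'f)"
      by (auto simp: trunc_def unit_seq_def)
    then show "1 \<le> B.operator_norm (B.coord_projection {..m})"
      unfolding B.operator_norm_def proj
      by (intro SUP_upper2[where i = "unit_seq 0"]) (auto simp: unit_seq_X nrm_unit_seq)
  qed
  then show ?thesis
    by (simp add: B.monotone_basis_def)
qed

end

section \<open>A weighted tree\<close>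

lemma power_powr_swap:
  fixes x :: real
  assumes "0 < x"
  shows "(x ^ m) powr c = (x powr c) ^ m"
  using assms by (simp add: powr_powr mult.commute flip: powr_realpow)

text \<open>Splits a cardinality into a normalising factor and the growth rate of the norm. At
  \<open>m = 0\<close> both sides vanish, as \<open>0 powr x = 0\<close> even for the exponent
  \<open>0\<close> that occurs when \<open>p = 1\<close>.\<close>

lemma of_nat_eq_powr_mult: "real m = real m powr (1 - 1 / p) * real m powr (1 / p)"
proof (cases "m = 0")
  case False
  have "real m powr (1 - 1 / p) * real m powr (1 / p) = real m powr (1 - 1 / p + 1 / p)"
    by (simp only: powr_add)
  then show ?thesis
    using False by simp
qed simp

text \<open>From one level to the next the \<open>1 / p\<close> power of the number of nodes grows
  by \<open>2 * q\<close> while the weight drops only by \<open>q\<close>. The lower bound on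
  \<open>q\<close> absorbs all powers of \<open>2\<close> that arise from this surplus.\<close>

locale tree =
  fixes b k :: nat and p q :: real
  assumes p_ge_1: "1 \<le> p" and b_ge_2: "2 \<le> b" and q_large: "2 ^ (k + 2) \<le> q"
    and b_powr: "real b powr (1 / p) = 2 * q"
begin

definition T :: "nat set" where
  "T = {b ^ k..<2 * b ^ k}"

definition weight :: "nat \<Rightarrow> real" where
  "weight n = q ^ multiplicity b n / q ^ k"

lemma q_ge_4: "4 \<le> q"
proof -
  have "(4::real) = 2 ^ 2"
    by simp
  also have "\<dots> \<le> 2 ^ (k + 2)"
    by (intro power_increasing) auto
  finally show ?thesis
    using q_large by linarith
qed

lemma weight_pos: "0 < weight n"
  using q_ge_4 by (simp add: weight_def)

lemma finite_T: "finite T"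
  by (simp add: T_def)

section \<open>Levels of the tree and the critical level\<close>

lemma T_nonzero: "n \<in> T \<Longrightarrow> n \<noteq> 0"
  using b_ge_2 by (auto simp: T_def)

lemma power_dvd_iff: "n \<in> T \<Longrightarrow> b ^ t dvd n \<longleftrightarrow> t \<le> multiplicity b n"
  using b_ge_2 T_nonzero by (intro power_dvd_iff_le_multiplicity) auto

lemma multiplicity_le: "n \<in> T \<Longrightarrow> multiplicity b n \<le> k"
proof (rule ccontr)
  assume n: "n \<in> T" and "\<not> multiplicity b n \<le> k"
  then have "b ^ Suc k dvd n"
    unfolding power_dvd_iff[OF n] by simp
  then have "b ^ Suc k \<le> n"
    using T_nonzero[OF n] by (intro dvd_imp_le) auto
  moreover have "2 * b ^ k \<le> b ^ Suc k"
    using b_ge_2 by simp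
  moreover have "n < 2 * b ^ k"
    using n by (simp add: T_def)
  ultimately show False
    by linarith
qed

lemma weight_le_1: "n \<in> T \<Longrightarrow> weight n \<le> 1"
  using multiplicity_le q_ge_4 by (simp add: weight_def power_increasing)

text \<open>Dividing the multiples of \<open>b ^ t\<close> in the block by \<open>b ^ t\<close> maps
  them into the block of depth \<open>k - t\<close>.\<close>

lemma card_level_le:
  assumes "t \<le> k"
  shows "card {n \<in> T. t \<le> multiplicity b n} \<le> b ^ (k - t)"
proof -
  have "{n \<in> T. t \<le> multiplicity b n} \<subseteq> (\<lambda>u. b ^ t * u) ` {b ^ (k - t)..<2 * b ^ (k - t)}"
  proof
    fix n assume n: "n \<in> {n \<in> T. t \<le> multiplicity b n}"
    then have "b ^ t dvd n"
      by (simp add: power_dvd_iff)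
    then obtain u where u: "n = b ^ t * u" ..
    have "b ^ (t + (k - t)) \<le> n" "n < 2 * b ^ (t + (k - t))"
      using n assms by (auto simp: T_def)
    then have "b ^ t * b ^ (k - t) \<le> b ^ t * u" "b ^ t * u < b ^ t * (2 * b ^ (k - t))"
      unfolding u power_add mult.left_commute[of 2] by this+
    moreover have "0 < b ^ t"
      using b_ge_2 by simp
    ultimately have "u \<in> {b ^ (k - t)..<2 * b ^ (k - t)}"
      by (simp only: nat_mult_le_cancel1 nat_mult_less_cancel1 atLeastLessThan_iff)
    then show "n \<in> (\<lambda>u. b ^ t * u) ` {b ^ (k - t)..<2 * b ^ (k - t)}"
      using u by blast
  qed
  then have "card {n \<in> T. t \<le> multiplicity b n} \<le> card {b ^ (k - t)..<2 * b ^ (k - t)}"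
    by (intro surj_card_le) auto
  then show ?thesis
    by simp
qed

text \<open>The critical \<open>\<sigma>\<close> is the least one for which the nodes above it,
  those closer to the root, number at most half of \<open>card A\<close>. If it is positive,
  minimality bounds \<open>card A\<close> by twice the number of nodes on or above it, and this
  makes the weights below it negligible.\<close>

lemma obtain_level:
  assumes "A \<subseteq> T"
  obtains \<sigma> where "\<sigma> \<le> k" "2 * card {n \<in> T. \<sigma> < multiplicity b n} \<le> card A"
    "\<sigma> = 0 \<or> real (card A) powr (1 / p) * (q ^ (\<sigma> - 1) / q ^ k) \<le> 1"
proof -
  let ?P = "\<lambda>\<sigma>. 2 * card {n \<in> T. \<sigma> < multiplicity b n} \<le> card A"
  define \<sigma> where "\<sigma> = (LEAST \<sigma>. ?P \<sigma>)"
  have "{n \<in> T. k < multiplicity b n} = {}"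
    using multiplicity_le by fastforce
  then have Pk: "?P k"
    by (metis card.empty mult_0_right zero_le)
  have P: "?P \<sigma>" and \<sigma>: "\<sigma> \<le> k"
    unfolding \<sigma>_def by (rule LeastI[of ?P, OF Pk], rule Least_le[of ?P, OF Pk])
  have "real (card A) powr (1 / p) * (q ^ s / q ^ k) \<le> 1" if s: "\<sigma> = Suc s" for s
  proof -
    have "\<not> ?P s"
      using not_less_Least[of s ?P] s unfolding \<sigma>_def by simp
    moreover have "card {n \<in> T. s < multiplicity b n} \<le> b ^ (k - Suc s)"
      using card_level_le[of "Suc s"] \<sigma> s by (simp add: Suc_le_eq)
    ultimately have "card A \<le> 2 * b ^ (k - Suc s)"
      by simp
    then have "real (card A) \<le> 2 * real b ^ (k - Suc s)"
      using of_nat_mono[where 'a = real] by fastforce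
    then have "real (card A) powr (1 / p) \<le> (2 * real b ^ (k - Suc s)) powr (1 / p)"
      using p_ge_1 by (intro powr_mono2) auto
    also have "\<dots> = 2 powr (1 / p) * (2 * q) ^ (k - Suc s)"
      using b_ge_2 by (simp add: powr_mult power_powr_swap b_powr)
    also have "\<dots> \<le> 2 powr 1 * (2 * q) ^ (k - Suc s)"
      using p_ge_1 q_ge_4 by (intro mult_right_mono powr_mono) auto
    finally have le: "real (card A) powr (1 / p) \<le> 2 * (2 * q) ^ (k - Suc s)"
      by simp
    have "real (card A) powr (1 / p) * (q ^ s / q ^ k) \<le> 2 * (2 * q) ^ (k - Suc s) * (q ^ s / q ^ k)"
      using q_ge_4 by (intro mult_right_mono le) simp
    \<comment> \<open>The powers of \<open>q\<close> cancel up to one factor \<open>q\<close> in the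
      denominator, which beats the remaining powers of \<open>2\<close>.\<close>
    also have "\<dots> = 2 * 2 ^ (k - Suc s) / q"
    proof -
      have "q ^ k = q ^ (k - Suc s) * q ^ s * q"
        using \<sigma> s power_add[of q "(k - Suc s) + s" 1] power_add[of q "k - Suc s" s] by simp
      then show ?thesis
        using q_ge_4 by (simp add: power_mult_distrib field_simps)
    qed
    also have "\<dots> \<le> 1"
    proof -
      have "(2::real) * 2 ^ (k - Suc s) = 2 ^ Suc (k - Suc s)"
        by simp
      also have "\<dots> \<le> 2 ^ (k + 2)"
        by (intro power_increasing) auto
      also have "\<dots> \<le> q"
        by (rule q_large)
      finally show ?thesis
        using q_ge_4 by simp
    qed
    finally show ?thesis .
  qed
  then have "\<sigma> = 0 \<or> real (card A) powr (1 / p) * (q ^ (\<sigma> - 1) / q ^ k) \<le> 1"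
    by (cases \<sigma>) auto
  with that P \<sigma> show ?thesis
    by blast
qed

section \<open>Families of siblings and the functional on one tree\<close>

lemma card_block_le:
  assumes "A \<subseteq> T"
  shows "card {n \<in> A. \<sigma> \<le> multiplicity b n \<and> n div b ^ Suc \<sigma> = j} \<le> b"
proof -
  \<comment> \<open>An interval of length \<open>b ^ Suc \<sigma>\<close> that starts at a multiple
    of its length contains \<open>b\<close> multiples of \<open>b ^ \<sigma>\<close>, namely a
    parent and its children.\<close>
  have "{n \<in> A. \<sigma> \<le> multiplicity b n \<and> n div b ^ Suc \<sigma> = j} \<subseteq> (\<lambda>u. b ^ \<sigma> * u) ` {b * j..<b * j + b}"
  proof
    fix n assume n: "n \<in> {n \<in> A. \<sigma> \<le> multiplicity b n \<and> n div b ^ Suc \<sigma> = j}"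
    then have "b ^ \<sigma> dvd n"
      using assms by (subst power_dvd_iff) auto
    then obtain u where u: "n = b ^ \<sigma> * u" ..
    have "u div b = j"
      using n b_ge_2 by (simp add: u mult.commute[of b])
    then have "u = b * j + u mod b"
      using mult_div_mod_eq[of b u] by simp
    moreover have "u mod b < b"
      using b_ge_2 by simp
    ultimately have "u \<in> {b * j..<b * j + b}"
      unfolding atLeastLessThan_iff by linarith
    then show "n \<in> (\<lambda>u. b ^ \<sigma> * u) ` {b * j..<b * j + b}"
      using u by blast
  qed
  then have "card {n \<in> A. \<sigma> \<le> multiplicity b n \<and> n div b ^ Suc \<sigma> = j} \<le> card {b * j..<b * j + b}"
    by (intro surj_card_le) auto
  then show ?thesis
    by simp
qed

text \<open>Meant for the size \<open>m\<close> of a family. The factor \<open>q\<close> lost here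
  is regained from the ratio between the weights of parent and child.\<close>

lemma le_powr_mult_q:
  assumes "m \<le> b"
  shows "real m \<le> 2 * q * real m powr (1 - 1 / p)"
proof -
  have "real m = real m powr (1 - 1 / p) * real m powr (1 / p)"
    by (rule of_nat_eq_powr_mult)
  also have "\<dots> \<le> real m powr (1 - 1 / p) * real b powr (1 / p)"
    using assms p_ge_1 by (intro mult_left_mono powr_mono2) auto
  finally show ?thesis
    by (simp add: b_powr mult.commute)
qed

text \<open>On the part of \<open>A\<close> on or below the critical level \<open>h\<close> is
  \<open>1 / f\<close>, and \<open>e\<close> is the size of that part. The other values of
  \<open>h\<close> are corrections at the parents; \<open>c\<close> counts the children that a
  correction serves and so controls its size.\<close>

lemma tree_functional:
  fixes f :: "nat \<Rightarrow> 'f::real_normed_field"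
  assumes AT: "A \<subseteq> T" and f_le: "\<And>n. n \<in> T \<Longrightarrow> norm (f n) \<le> 1" and f_A: "\<And>n. n \<in> A \<Longrightarrow> norm (f n) = 1"
  obtains h :: "nat \<Rightarrow> 'f" and c :: "nat \<Rightarrow> nat" and e :: nat
  where "\<And>n. n \<notin> T \<Longrightarrow> h n = 0"
    "\<And>n. norm (h n) \<le> indicator A n + 2 * real (c n) powr (1 - 1 / p)"
    "(\<Sum>n\<in>T. c n) \<le> card A"
    "card A \<le> 2 * e" "norm ((\<Sum>n\<in>T. h n * f n) - of_nat e) \<le> real (card A) / 4"
    "\<And>m. norm (\<Sum>n\<in>T \<inter> {..<m}. h n * of_real (weight n)) \<le> 3 * real (card A) powr (1 - 1 / p)"
proof -
  obtain \<sigma> where \<sigma>: "\<sigma> \<le> k" "2 * card {n \<in> T. \<sigma> < multiplicity b n} \<le> card A"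
    "\<sigma> = 0 \<or> real (card A) powr (1 / p) * (q ^ (\<sigma> - 1) / q ^ k) \<le> 1"
    using obtain_level[OF AT] .
  \<comment> \<open>Rounding down to a multiple of \<open>D\<close> gives the parent of a node on
    the critical level. A parent may have multiplicity greater than \<open>Suc \<sigma>\<close>, so
    only lower bounds on its weight are available.\<close>
  define D where "D = b ^ Suc \<sigma>"
  define par where "par n = D * (n div D)" for n
  define K where "K i = {n \<in> A. multiplicity b n = \<sigma> \<and> par n = i}" for i
  define P where "P = {i \<in> T. D dvd i}"
  define A1 where "A1 = {n \<in> A. multiplicity b n \<le> \<sigma>}"
  define e where "e n = inverse (f n) * of_real (weight n)" for n
  define c where "c i = (if i \<in> P then card (K i) else 0)" for i
  \<comment> \<open>The correction at the parents makes \<open>h\<close> orthogonal to the weight on every family \<open>{i} \<union> K i\<close>.\<close>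
  define h where "h n = (if n \<in> A1 then inverse (f n)
      else if n \<in> P then - (\<Sum>j\<in>K n. e j) / of_real (weight n) else 0)" for n
  define \<mu> where "\<mu> = card A"
  have fin: "finite A" "finite P" "finite A1" "finite (K i)" for i
    using finite_subset[OF AT finite_T] finite_T by (auto simp: P_def A1_def K_def)
  have D_pos: "0 < D"
    using b_ge_2 by (simp add: D_def)
  have P_iff: "n \<in> P \<longleftrightarrow> n \<in> T \<and> \<sigma> < multiplicity b n" for n
    unfolding P_def D_def using power_dvd_iff[of n "Suc \<sigma>"] by auto
  have disj: "A1 \<inter> P = {}"
    by (auto simp: A1_def P_iff)
  have A1T: "A1 \<subseteq> T" and PT: "P \<subseteq> T"
    using AT by (auto simp: A1_def P_def)
  have h_A1: "h n = inverse (f n)" if "n \<in> A1" for n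
    using that by (simp add: h_def)
  have h_P: "h n = - (\<Sum>j\<in>K n. e j) / of_real (weight n)" if "n \<in> P" for n
    using that disj by (auto simp: h_def)
  have h_0: "h n = 0" if "n \<notin> A1" "n \<notin> P" for n
    using that by (simp add: h_def)
  have split: "(\<Sum>n\<in>T \<inter> S. h n * u n) = (\<Sum>n\<in>A1 \<inter> S. h n * u n) + (\<Sum>n\<in>P \<inter> S. h n * u n)" for S u
  proof -
    have "(\<Sum>n\<in>T \<inter> S. h n * u n) = (\<Sum>n\<in>(A1 \<inter> S) \<union> (P \<inter> S). h n * u n)"
      using finite_T A1T PT h_0 by (intro sum.mono_neutral_right) auto
    also have "\<dots> = (\<Sum>n\<in>A1 \<inter> S. h n * u n) + (\<Sum>n\<in>P \<inter> S. h n * u n)"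
      using fin disj by (intro sum.union_disjoint) auto
    finally show ?thesis .
  qed
  have par_eq: "n div D = i div D" if "par n = i" for n i
    using that D_pos by (auto simp: par_def)
  have card_K: "card (K i) \<le> b" for i
  proof -
    have "K i \<subseteq> {n \<in> A. \<sigma> \<le> multiplicity b n \<and> n div b ^ Suc \<sigma> = i div D}"
      unfolding D_def[symmetric] using par_eq[of _ i] by (auto simp only: K_def)
    then have "card (K i) \<le> card {n \<in> A. \<sigma> \<le> multiplicity b n \<and> n div b ^ Suc \<sigma> = i div D}"
      by (intro card_mono) (simp_all add: fin)
    also have "\<dots> \<le> b"
      by (rule card_block_le[OF AT])
    finally show ?thesis .
  qed
  have par_le: "par n \<le> n" for n
    using times_div_less_eq_dividend[of D n] by (simp add: par_def)
  \<comment> \<open>For \<open>\<sigma> < k\<close> the left end \<open>b ^ k\<close> of the block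
    is a multiple of \<open>D\<close>, so rounding down does not leave the block.\<close>
  have par_P: "par n \<in> P" if n: "n \<in> A" and k: "\<sigma> < k" for n
  proof -
    have "n \<in> T"
      using n AT by blast
    have "D dvd b ^ k"
      unfolding D_def using k by (intro le_imp_power_dvd) simp
    then obtain l where l: "b ^ k = D * l" ..
    then have "D * l \<le> n"
      using \<open>n \<in> T\<close> by (simp add: T_def)
    then have "l \<le> n div D"
      using D_pos by (simp add: less_eq_div_iff_mult_less_eq mult.commute)
    then have "b ^ k \<le> par n"
      unfolding l par_def by (rule mult_le_mono2)
    moreover have "par n < 2 * b ^ k"
      using par_le[of n] \<open>n \<in> T\<close> by (simp add: T_def)
    ultimately show ?thesis
      unfolding P_def T_def by (simp add: par_def)
  qed
  have P_empty: "P = {}" if "\<not> \<sigma> < k"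
    using that P_iff multiplicity_le by fastforce
  have norm_e: "norm (e n) = weight n" if "n \<in> A" for n
    using f_A[OF that] weight_pos[of n] by (simp add: e_def norm_mult norm_inverse)
  have norm_e_K: "norm (e n) = q ^ \<sigma> / q ^ k" if "n \<in> A" "multiplicity b n = \<sigma>" for n
    using norm_e[OF that(1)] that(2) by (simp add: weight_def)
  have norm_sum_e: "norm (\<Sum>n\<in>B. e n) \<le> real (card B) * (q ^ \<sigma> / q ^ k)"
    if "B \<subseteq> {n \<in> A. multiplicity b n = \<sigma>}" for B
  proof -
    have "norm (\<Sum>n\<in>B. e n) \<le> (\<Sum>n\<in>B. q ^ \<sigma> / q ^ k)"
      using norm_e_K that by (intro sum_norm_le) (auto intro: eq_refl)
    then show ?thesis
      by simp
  qed
  have norm_h_P: "norm (h i) \<le> real (c i) / q" if i: "i \<in> P" for i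
  proof -
    \<comment> \<open>A parent weighs at least \<open>q\<close> times as much as a child, so
      cancelling its family takes mass at most \<open>1 / q\<close> per child.\<close>
    have "q ^ Suc \<sigma> / q ^ k \<le> weight i"
      unfolding weight_def using i P_iff q_ge_4
      by (intro divide_right_mono power_increasing) (auto simp: Suc_le_eq)
    moreover have "norm (\<Sum>j\<in>K i. e j) \<le> real (card (K i)) * (q ^ \<sigma> / q ^ k)"
      by (rule norm_sum_e) (auto simp: K_def)
    ultimately have "norm (\<Sum>j\<in>K i. e j) / weight i \<le> real (card (K i)) * (q ^ \<sigma> / q ^ k) / (q ^ Suc \<sigma> / q ^ k)"
      using q_ge_4 by (intro frac_le) auto
    also have "\<dots> = real (c i) / q"
      using q_ge_4 i by (simp add: c_def)
    finally show ?thesis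
      using weight_pos[of i] by (simp add: h_P[OF i] norm_divide)
  qed
  have c_le: "c i \<le> b" for i
    using card_K by (simp add: c_def)
  have "norm (h n) \<le> indicator A n + 2 * real (c n) powr (1 - 1 / p)" for n
  proof -
    consider "n \<in> A1" | "n \<in> P" | "n \<notin> A1" "n \<notin> P"
      by blast
    then show ?thesis
    proof cases
      case 1
      then show ?thesis
        using f_A[of n] by (simp add: h_A1 A1_def norm_inverse)
    next
      case 2
      have "real (c n) / q \<le> 2 * real (c n) powr (1 - 1 / p)"
        using le_powr_mult_q[OF c_le[of n]] q_ge_4 by (simp add: field_simps)
      then show ?thesis
        using norm_h_P[OF 2] by (auto simp: indicator_def)
    qed (simp add: h_0)
  qed
  moreover have sum_c: "(\<Sum>n\<in>T. c n) \<le> card A"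
  proof -
    have "(\<Sum>n\<in>T. c n) = (\<Sum>n\<in>P. card (K n))"
      using finite_T PT by (intro sum.mono_neutral_cong_right) (auto simp: c_def)
    also have "\<dots> = card (\<Union>n\<in>P. K n)"
      using fin by (intro card_UN_disjoint[symmetric]) (auto simp: K_def)
    also have "\<dots> \<le> card A"
      using fin by (intro card_mono) (auto simp: K_def)
    finally show ?thesis .
  qed
  \<comment> \<open>\<open>card A1\<close> becomes the number \<open>e\<close> of the conclusion,
    which is unrelated to the local function \<open>e\<close>.\<close>
  moreover have "card A \<le> 2 * card A1"
  proof -
    have "card A \<le> card (A1 \<union> {n \<in> T. \<sigma> < multiplicity b n})"
      using AT fin finite_T by (intro card_mono) (auto simp: A1_def)
    also have "\<dots> \<le> card A1 + card {n \<in> T. \<sigma> < multiplicity b n}"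
      by (rule card_Un_le)
    finally show ?thesis
      using \<sigma>(2) by linarith
  qed
  moreover have "norm ((\<Sum>n\<in>T. h n * f n) - of_nat (card A1)) \<le> real (card A) / 4"
  proof -
    have "h n * f n = 1" if "n \<in> A1" for n
    proof -
      have "norm (f n) = 1"
        using that by (intro f_A) (simp add: A1_def)
      then have "f n \<noteq> 0"
        by auto
      then show ?thesis
        by (simp add: h_A1[OF that])
    qed
    then have "(\<Sum>n\<in>T. h n * f n) - of_nat (card A1) = (\<Sum>n\<in>P. h n * f n)"
      using split[of f UNIV] by simp
    also have "norm \<dots> \<le> (\<Sum>n\<in>P. real (c n) / q)"
    proof (rule sum_norm_le)
      fix i assume i: "i \<in> P"
      then have "norm (h i) * norm (f i) \<le> norm (h i) * 1"
        using f_le PT by (intro mult_left_mono) auto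
      then show "norm (h i * f i) \<le> real (c i) / q"
        using norm_h_P[OF i] by (simp add: norm_mult)
    qed
    also have "\<dots> = real (\<Sum>n\<in>P. c n) / q"
      by (simp add: sum_divide_distrib)
    also have "\<dots> \<le> real (card A) / 4"
    proof (intro frac_le)
      have "(\<Sum>n\<in>P. c n) \<le> (\<Sum>n\<in>T. c n)"
        using finite_T PT by (intro sum_mono2) auto
      then show "real (\<Sum>n\<in>P. c n) \<le> real (card A)"
        using sum_c by linarith
    qed (use q_ge_4 in auto)
    finally show ?thesis .
  qed
  moreover have "norm (\<Sum>n\<in>T \<inter> {..<m}. h n * of_real (weight n)) \<le> 3 * real \<mu> powr (1 - 1 / p)" for m
  proof -
    \<comment> \<open>Three parts contribute: the levels below the critical one are small outright,
      whereas the critical level and the parents have to be estimated together.\<close>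
    let ?L = "{n \<in> A. multiplicity b n < \<sigma> \<and> n < m}"
    let ?S = "{n \<in> A. multiplicity b n = \<sigma> \<and> n < m}"
    have A1_part: "(\<Sum>n\<in>A1 \<inter> {..<m}. h n * of_real (weight n)) = (\<Sum>n\<in>?L. e n) + (\<Sum>n\<in>?S. e n)"
    proof -
      have "(\<Sum>n\<in>A1 \<inter> {..<m}. h n * of_real (weight n)) = (\<Sum>n\<in>?L \<union> ?S. e n)"
        by (intro sum.cong) (auto simp: A1_def h_A1 e_def)
      also have "\<dots> = (\<Sum>n\<in>?L. e n) + (\<Sum>n\<in>?S. e n)"
        using fin by (intro sum.union_disjoint) auto
      finally show ?thesis .
    qed
    have \<mu>_split: "real \<mu> = real \<mu> powr (1 - 1 / p) * real \<mu> powr (1 / p)"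
      by (rule of_nat_eq_powr_mult)
    have low: "norm (\<Sum>n\<in>?L. e n) \<le> real \<mu> powr (1 - 1 / p)"
    proof (cases \<sigma>)
      case (Suc s)
      have "norm (\<Sum>n\<in>?L. e n) \<le> (\<Sum>n\<in>?L. q ^ s / q ^ k)"
      proof (rule sum_norm_le)
        fix n assume n: "n \<in> ?L"
        then have "norm (e n) = weight n"
          by (intro norm_e) auto
        also have "\<dots> \<le> q ^ s / q ^ k"
          unfolding weight_def using n Suc q_ge_4 by (intro divide_right_mono power_increasing) auto
        finally show "norm (e n) \<le> q ^ s / q ^ k" .
      qed
      also have "\<dots> = real (card ?L) * (q ^ s / q ^ k)"
        by simp
      also have "\<dots> \<le> real \<mu> * (q ^ s / q ^ k)"
        unfolding \<mu>_def using fin q_ge_4 by (intro mult_right_mono of_nat_mono card_mono) auto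
      also have "\<dots> = real \<mu> powr (1 - 1 / p) * (real \<mu> powr (1 / p) * (q ^ s / q ^ k))"
        by (subst \<mu>_split) (simp only: mult.assoc)
      also have "\<dots> \<le> real \<mu> powr (1 - 1 / p) * 1"
        using \<sigma>(3) Suc by (intro mult_left_mono) (auto simp: \<mu>_def)
      finally show ?thesis
        by simp
    qed simp
    \<comment> \<open>At most one family is cut by \<open>m\<close>, and only the children not below \<open>m\<close> contribute.\<close>
    have rest: "norm ((\<Sum>n\<in>?S. e n) + (\<Sum>n\<in>P \<inter> {..<m}. h n * of_real (weight n)))
      \<le> 2 * real \<mu> powr (1 - 1 / p)"
    proof (cases "\<sigma> < k")
      case True
      \<comment> \<open>Parents precede their children, so the parents before \<open>m\<close>
        cancel all of \<open>?S\<close> and in addition \<open>?R\<close>, the children that the cut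
        leaves out.\<close>
      let ?S' = "{n \<in> A. multiplicity b n = \<sigma> \<and> par n < m}"
      let ?R = "{n \<in> A. multiplicity b n = \<sigma> \<and> par n < m \<and> m \<le> n}"
      have "(\<Sum>n\<in>P \<inter> {..<m}. h n * of_real (weight n)) = (\<Sum>i\<in>P \<inter> {..<m}. - (\<Sum>n\<in>K i. e n))"
      proof (rule sum.cong)
        fix i assume "i \<in> P \<inter> {..<m}"
        then show "h i * of_real (weight i) = - (\<Sum>n\<in>K i. e n)"
          using weight_pos[of i] by (simp add: h_P)
      qed simp
      also have "\<dots> = - (\<Sum>i\<in>P \<inter> {..<m}. \<Sum>n\<in>{n \<in> ?S'. par n = i}. e n)"
        unfolding sum_negf K_def
        by (intro arg_cong[of _ _ uminus] sum.cong) auto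
      also have "(\<Sum>i\<in>P \<inter> {..<m}. \<Sum>n\<in>{n \<in> ?S'. par n = i}. e n) = (\<Sum>n\<in>?S'. e n)"
        using fin par_P True by (intro sum.group) auto
      also have "?S' = ?S \<union> ?R"
        using par_le order_le_less_trans by (auto simp: not_less)
      also have "(\<Sum>n\<in>?S \<union> ?R. e n) = (\<Sum>n\<in>?S. e n) + (\<Sum>n\<in>?R. e n)"
        using fin by (intro sum.union_disjoint) auto
      finally have "norm ((\<Sum>n\<in>?S. e n) + (\<Sum>n\<in>P \<inter> {..<m}. h n * of_real (weight n))) = norm (\<Sum>n\<in>?R. e n)"
        by simp
      also have "\<dots> \<le> real (card ?R) * (q ^ \<sigma> / q ^ k)"
        by (rule norm_sum_e) auto
      also have "\<dots> \<le> 2 * q * real (card ?R) powr (1 - 1 / p) * (q ^ \<sigma> / q ^ k)"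
      proof (intro mult_right_mono le_powr_mult_q)
        \<comment> \<open>From \<open>par n \<le> m - 1 < n\<close> the points \<open>n\<close> and
          \<open>m - 1\<close> share an interval of length \<open>D\<close>, so \<open>?R\<close>
          lies in a single family.\<close>
        have "n div D = (m - 1) div D" if "par n < m" "m \<le> n" for n
        proof (rule antisym)
          show "n div D \<le> (m - 1) div D"
            using that D_pos by (simp add: less_eq_div_iff_mult_less_eq par_def mult.commute)
          show "(m - 1) div D \<le> n div D"
            using that by (intro div_le_mono) simp
        qed
        then have "?R \<subseteq> {n \<in> A. \<sigma> \<le> multiplicity b n \<and> n div b ^ Suc \<sigma> = (m - 1) div D}"
          unfolding D_def[symmetric] by auto
        then have "card ?R \<le> card {n \<in> A. \<sigma> \<le> multiplicity b n \<and> n div b ^ Suc \<sigma> = (m - 1) div D}"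
          by (intro card_mono) (simp_all add: fin)
        also have "\<dots> \<le> b"
          by (rule card_block_le[OF AT])
        finally show "card ?R \<le> b" .
      qed (use q_ge_4 in auto)
      also have "\<dots> \<le> 2 * q * real \<mu> powr (1 - 1 / p) * (q ^ \<sigma> / q ^ k)"
        unfolding \<mu>_def using fin q_ge_4 p_ge_1
        by (intro mult_right_mono mult_left_mono powr_mono2 of_nat_mono card_mono) auto
      also have "\<dots> = 2 * real \<mu> powr (1 - 1 / p) * (q ^ Suc \<sigma> / q ^ k)"
        by simp
      also have "\<dots> \<le> 2 * real \<mu> powr (1 - 1 / p) * 1"
        using True q_ge_4 by (intro mult_left_mono) (auto simp: Suc_le_eq intro!: power_increasing simp del: power_Suc)
      finally show ?thesis
        by simp
    next
      case False
      then have "\<sigma> = k"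
        using \<sigma>(1) by simp
      \<comment> \<open>The critical level consists of the root alone, which has weight
        \<open>1\<close> and no parent. The case \<open>\<mu> = 0\<close> is treated apart below
        because \<open>0 powr 0 = 0\<close>.\<close>
      have "card ?S \<le> 1"
      proof -
        have "card ?S \<le> card {n \<in> T. k \<le> multiplicity b n}"
          using AT finite_T \<open>\<sigma> = k\<close> by (intro card_mono) auto
        then show ?thesis
          using card_level_le[of k] by simp
      qed
      moreover have "card ?S \<le> \<mu>"
        unfolding \<mu>_def using fin by (intro card_mono) auto
      ultimately have "real (card ?S) \<le> real \<mu> powr (1 - 1 / p)"
        using p_ge_1 by (cases "\<mu> = 0") (auto intro!: order_trans[OF _ ge_one_powr_ge_zero])
      moreover have "norm (\<Sum>n\<in>?S. e n) \<le> real (card ?S) * (q ^ \<sigma> / q ^ k)"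
        by (rule norm_sum_e) auto
      ultimately show ?thesis
        using P_empty[OF False] \<open>\<sigma> = k\<close> q_ge_4 powr_ge_zero[of "real \<mu>" "1 - 1 / p"] by simp
    qed
    have "(\<Sum>n\<in>T \<inter> {..<m}. h n * of_real (weight n)) =
      (\<Sum>n\<in>?L. e n) + ((\<Sum>n\<in>?S. e n) + (\<Sum>n\<in>P \<inter> {..<m}. h n * of_real (weight n)))"
      unfolding split A1_part by (rule add.assoc)
    then show ?thesis
      using norm_triangle_mono[OF low rest] by simp
  qed
  moreover have "h n = 0" if "n \<notin> T" for n
    using that A1T PT by (intro h_0) auto
  ultimately show thesis
    unfolding \<mu>_def by (intro that)
qed

end

section \<open>The basis\<close>

text \<open>Any radix that is large enough for \<open>ratio p k \<ge> 2 ^ (k + 2)\<close> and for disjoint blocks will do;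
  powers of \<open>2\<close> make the latter a comparison of exponents.\<close>

definition radix :: "real \<Rightarrow> nat \<Rightarrow> nat" where
  "radix p k = 2 ^ (nat \<lceil>p\<rceil> * (k + 3))"

definition ratio :: "real \<Rightarrow> nat \<Rightarrow> real" where
  "ratio p k = real (radix p k) powr (1 / p) / 2"

abbreviation block :: "real \<Rightarrow> nat \<Rightarrow> nat set" where
  "block p k \<equiv> tree.T (radix p k) k"

abbreviation block_weight :: "real \<Rightarrow> nat \<Rightarrow> nat \<Rightarrow> real" where
  "block_weight p k \<equiv> tree.weight (radix p k) k (ratio p k)"

text \<open>The first condition describes the unit ball of the Marcinkiewicz space dual to the
  Lorentz space l_{p,1}; for \<open>p = 1\<close> it is the ball of l_infinity.\<close>

definition dual_ball :: "real \<Rightarrow> (nat \<Rightarrow> 'f::{real_normed_field,banach}) set" where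
  "dual_ball p = {h. (\<forall>B. finite B \<longrightarrow> (\<Sum>n\<in>B. norm (h n)) \<le> real (card B) powr (1 / p)) \<and>
     (\<forall>k m. norm (\<Sum>n\<in>block p k \<inter> {..<m}. h n * of_real (block_weight p k n)) \<le> 1)}"

text \<open>Since \<open>nat \<lceil>p\<rceil> / p \<ge> 1\<close>, the \<open>1 / p\<close> power
  of the radix is at least \<open>2 ^ (k + 3)\<close>, and \<open>ratio\<close> is half of
  it.\<close>

lemma tree_radix:
  assumes p: "1 \<le> p"
  shows "tree (radix p k) k p (ratio p k)"
proof
  have P: "p \<le> real (nat \<lceil>p\<rceil>)" "1 \<le> nat \<lceil>p\<rceil>"
    using p by linarith+
  have "(2::nat) ^ 1 \<le> radix p k"
    unfolding radix_def using P(2) by (intro power_increasing) auto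
  then show "2 \<le> radix p k"
    by simp
  have "(2::real) ^ (k + 3) = 2 powr real (k + 3)"
    by (rule powr_realpow[symmetric]) simp
  also have "\<dots> \<le> 2 powr (real (nat \<lceil>p\<rceil> * (k + 3)) * (1 / p))"
  proof (rule powr_mono)
    have "p * real (k + 3) \<le> real (nat \<lceil>p\<rceil>) * real (k + 3)"
      using P by (intro mult_right_mono) auto
    then show "real (k + 3) \<le> real (nat \<lceil>p\<rceil> * (k + 3)) * (1 / p)"
      using p by (simp add: field_simps)
  qed simp
  also have "\<dots> = 2 * ratio p k"
    unfolding ratio_def radix_def by (simp add: powr_powr flip: powr_realpow)
  finally show "2 ^ (k + 2) \<le> ratio p k"
    by (simp add: power_add)
qed (use p in \<open>simp_all add: ratio_def\<close>)

lemma block_eq: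
  assumes "1 \<le> p"
  shows "block p k = {radix p k ^ k..<2 * radix p k ^ k}"
  by (rule tree.T_def[OF tree_radix[OF assms]])

lemma finite_block: "1 \<le> p \<Longrightarrow> finite (block p k)"
  by (simp add: block_eq)

text \<open>Left ends of blocks are powers of \<open>2\<close> with strictly increasing exponents,
  so a later left end is at least twice an earlier one, which is the right end of the earlier
  block.\<close>

lemma block_disjoint:
  assumes p: "1 \<le> p" and "j < k"
  shows "block p j \<inter> block p k = {}"
proof -
  let ?e = "\<lambda>k. nat \<lceil>p\<rceil> * (k + 3) * k"
  have "(j + 3) * j < (k + 3) * k"
    using \<open>j < k\<close> by (intro mult_strict_mono) auto
  moreover have "0 < nat \<lceil>p\<rceil>"
    using p by simp
  ultimately have "nat \<lceil>p\<rceil> * ((j + 3) * j) < nat \<lceil>p\<rceil> * ((k + 3) * k)"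
    by (simp only: nat_mult_less_cancel1)
  then have "(2::nat) ^ Suc (?e j) \<le> 2 ^ ?e k"
    by (intro power_increasing) (simp_all only: mult.assoc Suc_le_eq one_le_numeral)
  then have "2 * radix p j ^ j \<le> radix p k ^ k"
    unfolding radix_def by (simp only: power_mult[symmetric] power_Suc)
  then show ?thesis
    unfolding block_eq[OF p] by auto
qed

lemma block_unique: "1 \<le> p \<Longrightarrow> n \<in> block p j \<Longrightarrow> n \<in> block p k \<Longrightarrow> j = k"
  using block_disjoint[of p j k] block_disjoint[of p k j] by (cases j k rule: linorder_cases) auto

text \<open>Ensures that a finite set meets only finitely many blocks, with an explicit bound on
  their indices.\<close>

lemma block_gt:
  assumes p: "1 \<le> p" and "n \<in> block p k"
  shows "k < n"
proof -
  have "k < 2 ^ k"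
    by (rule less_exp)
  also have "(2::nat) ^ k \<le> radix p k ^ k"
    using tree.b_ge_2[OF tree_radix[OF p]] by (intro power_mono) auto
  also have "\<dots> \<le> n"
    using assms by (simp add: block_eq)
  finally show ?thesis .
qed

lemma card_block_powr:
  assumes p: "1 \<le> p"
  shows "real (card (block p k)) powr (1 / p) = (2 * ratio p k) ^ k"
proof -
  interpret tree "radix p k" k p "ratio p k"
    by (rule tree_radix[OF p])
  have "card (block p k) = radix p k ^ k"
    by (simp add: block_eq[OF p])
  then show ?thesis
    using b_ge_2 by (simp add: power_powr_swap b_powr)
qed

lemma norming_dual_ball:
  assumes p: "1 \<le> p"
  shows "norming_set (dual_ball p :: (nat \<Rightarrow> 'f::{real_normed_field,banach}) set)"
proof
  fix h :: "nat \<Rightarrow> 'f" and n assume h: "h \<in> dual_ball p"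
  have "(\<Sum>n\<in>{n}. norm (h n)) \<le> real (card {n}) powr (1 / p)"
    using h unfolding dual_ball_def by blast
  then show "norm (h n) \<le> 1"
    by simp
next
  fix n
  have norm_unit: "norm (unit_seq n k :: 'f) = (if n = k then 1 else 0)" for k
    by (auto simp: unit_seq_def)
  have "(\<Sum>k\<in>B. norm (unit_seq n k :: 'f)) \<le> real (card B) powr (1 / p)" if "finite B" for B
  proof (cases "n \<in> B")
    case True
    then have "1 \<le> card B"
      using that by (simp add: Suc_le_eq card_gt_0_iff) auto
    then show ?thesis
      using p that by (simp add: norm_unit True ge_one_powr_ge_zero)
  qed (use that in \<open>simp add: norm_unit\<close>)
  moreover have "norm (\<Sum>j\<in>block p k \<inter> {..<m}. unit_seq n j * of_real (block_weight p k j) :: 'f) \<le> 1" for k m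
  proof -
    interpret tree "radix p k" k p "ratio p k"
      by (rule tree_radix[OF p])
    have "(\<Sum>j\<in>T \<inter> {..<m}. unit_seq n j * of_real (weight j) :: 'f)
        = (\<Sum>j\<in>T \<inter> {..<m}. if j = n then of_real (weight j) else 0)"
      by (intro sum.cong) (auto simp: unit_seq_def)
    also have "\<dots> = (if n \<in> T \<inter> {..<m} then of_real (weight n) else 0)"
      using finite_T by simp
    finally show ?thesis
      using weight_le_1[of n] weight_pos[of n] by simp
  qed
  ultimately show "unit_seq n \<in> (dual_ball p :: (nat \<Rightarrow> 'f) set)"
    by (simp add: dual_ball_def)
qed

section \<open>Lower norm estimates by a witness functional\<close>

lemma sum_powr_le:
  fixes c :: "nat \<Rightarrow> real"
  assumes p: "1 \<le> p" and B: "finite B" and M: "0 < M"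
    and c: "\<And>n. n \<in> B \<Longrightarrow> 0 \<le> c n" "(\<Sum>n\<in>B. c n) \<le> M"
  shows "(\<Sum>n\<in>B. c n powr (1 - 1 / p)) \<le> 2 * (M powr (1 - 1 / p) * real (card B) powr (1 / p))"
proof (cases "B = {}")
  case False
  let ?\<theta> = "1 - 1 / p" and ?N = "real (card B)"
  \<comment> \<open>Hoelder's inequality up to the factor \<open>2\<close>: with
    \<open>\<tau>\<close> the average of the allowed mass,
    \<open>x powr ?\<theta> \<le> 1 + x\<close> at \<open>x = c n / \<tau>\<close> bounds the sum by
    \<open>2 * ?N * \<tau> powr ?\<theta>\<close>.\<close>
  define \<tau> where "\<tau> = M / ?N"
  have N: "0 < ?N"
    using False B by (simp add: card_gt_0_iff)
  then have \<tau>: "0 < \<tau>"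
    using M by (simp add: \<tau>_def)
  have \<theta>: "0 \<le> ?\<theta>" "?\<theta> \<le> 1"
    using p by simp_all
  have "c n powr ?\<theta> \<le> \<tau> powr ?\<theta> * (1 + c n / \<tau>)" if n: "n \<in> B" for n
  proof -
    have "(c n / \<tau>) powr ?\<theta> \<le> 1 + c n / \<tau>"
    proof (cases "c n / \<tau> \<le> 1")
      case True
      then have "(c n / \<tau>) powr ?\<theta> \<le> 1 powr ?\<theta>"
        using c(1)[OF n] \<tau> \<theta> by (intro powr_mono2) auto
      moreover have "0 \<le> c n / \<tau>"
        using c(1)[OF n] \<tau> by simp
      ultimately show ?thesis
        by simp
    next
      case False
      then have "(c n / \<tau>) powr ?\<theta> \<le> (c n / \<tau>) powr 1"
        using \<theta> by (intro powr_mono) auto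
      then show ?thesis
        using c(1)[OF n] \<tau> by simp
    qed
    then have "\<tau> powr ?\<theta> * (c n / \<tau>) powr ?\<theta> \<le> \<tau> powr ?\<theta> * (1 + c n / \<tau>)"
      by (intro mult_left_mono) auto
    then show ?thesis
      using \<tau> c(1)[OF n] by (simp flip: powr_mult)
  qed
  then have "(\<Sum>n\<in>B. c n powr ?\<theta>) \<le> (\<Sum>n\<in>B. \<tau> powr ?\<theta> * (1 + c n / \<tau>))"
    by (rule sum_mono)
  also have "\<dots> = \<tau> powr ?\<theta> * (?N + (\<Sum>n\<in>B. c n) / \<tau>)"
    by (simp add: sum.distrib flip: sum_distrib_left sum_divide_distrib)
  also have "\<dots> \<le> \<tau> powr ?\<theta> * (?N + M / \<tau>)"
    using c(2) \<tau> by (intro mult_left_mono add_left_mono divide_right_mono) auto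
  also have "M / \<tau> = ?N"
    using M by (simp add: \<tau>_def)
  also have "\<tau> powr ?\<theta> = M powr ?\<theta> * ?N powr (- ?\<theta>)"
    unfolding \<tau>_def powr_divide powr_minus by (rule divide_inverse)
  also have "M powr ?\<theta> * ?N powr (- ?\<theta>) * (?N + ?N) = 2 * (M powr ?\<theta> * (?N powr (- ?\<theta>) * ?N powr 1))"
    using N by simp
  also have "?N powr (- ?\<theta>) * ?N powr 1 = ?N powr (1 / p)"
    by (simp only: powr_add[symmetric]) simp
  finally show ?thesis .
qed simp

lemma dual_ball_sum_le:
  assumes p: "1 \<le> p" and h: "h \<in> dual_ball p" and A: "finite A"
    and u: "\<And>n. n \<in> A \<Longrightarrow> norm (u n) \<le> 1"
  shows "norm (\<Sum>n\<in>A. h n * u n) \<le> real (card A) powr (1 / p)"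
proof -
  have "norm (\<Sum>n\<in>A. h n * u n) \<le> (\<Sum>n\<in>A. norm (h n))"
    using u by (intro sum_norm_le) (simp add: norm_mult mult_left_le)
  also have "\<dots> \<le> real (card A) powr (1 / p)"
    using h A by (auto simp: dual_ball_def)
  finally show ?thesis .
qed

lemma sum_lessThan_single:
  assumes "k < (N::nat)" "\<And>j. j \<noteq> k \<Longrightarrow> g j = (0::'a::comm_monoid_add)"
  shows "(\<Sum>j<N. g j) = g k"
proof -
  have "(\<Sum>j<N. g j) = (\<Sum>j\<in>{k}. g j)"
    using assms by (intro sum.mono_neutral_right) auto
  then show ?thesis
    by simp
qed

text \<open>The functionals of the individual trees are glued together, with \<open>1 / f\<close> on
  the part of \<open>A\<close> outside the blocks, and then scaled into the dual ball.\<close>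

lemma dual_ball_witness:
  fixes f :: "nat \<Rightarrow> 'f::{real_normed_field,banach}"
  assumes p: "1 \<le> p" and f_le: "\<And>n. norm (f n) \<le> 1"
    and A: "finite A" and f_A: "\<And>n. n \<in> A \<Longrightarrow> norm (f n) = 1"
  obtains h m where "h \<in> dual_ball p" "real (card A) powr (1 / p) \<le> 20 * norm (pairing m h f)"
proof (cases "A = {}")
  case True
  interpret norming_set "dual_ball p :: (nat \<Rightarrow> 'f) set"
    by (rule norming_dual_ball[OF p])
  \<comment> \<open>Any member of the dual ball will do, as
    \<open>0 powr (1 / p) = 0\<close>.\<close>
  show ?thesis
    using that[OF norming_unit] True by simp
next
  case False
  let ?\<theta> = "1 - 1 / p"
  define M where "M = card A"
  \<comment> \<open>By \<open>block_gt\<close>, blocks with index at least \<open>N\<close> miss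
    \<open>A\<close>.\<close>
  define N where "N = Suc (Max A)"
  define A' where "A' k = A \<inter> block p k" for k
  have M: "0 < M"
    using False A by (simp add: M_def card_gt_0_iff)
  \<comment> \<open>One predicate for the whole conclusion of \<open>tree_functional\<close> allows
    a simultaneous choice over all \<open>k\<close>.\<close>
  define good :: "nat \<Rightarrow> (nat \<Rightarrow> 'f) \<Rightarrow> (nat \<Rightarrow> nat) \<Rightarrow> nat \<Rightarrow> bool" where
    "good k h c e \<longleftrightarrow> (\<forall>n. n \<notin> block p k \<longrightarrow> h n = 0) \<and>
      (\<forall>n. norm (h n) \<le> indicator (A' k) n + 2 * real (c n) powr ?\<theta>) \<and>
      (\<Sum>n\<in>block p k. c n) \<le> card (A' k) \<and> card (A' k) \<le> 2 * e \<and>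
      norm ((\<Sum>n\<in>block p k. h n * f n) - of_nat e) \<le> real (card (A' k)) / 4 \<and>
      (\<forall>m. norm (\<Sum>n\<in>block p k \<inter> {..<m}. h n * of_real (block_weight p k n))
        \<le> 3 * real (card (A' k)) powr ?\<theta>)" for k h c e
  have "\<exists>h c e. good k h c e" for k
  proof (rule tree.tree_functional[OF tree_radix[OF p], of "A' k" k f])
    fix h c e
    assume *: "\<And>n. n \<notin> block p k \<Longrightarrow> h n = 0"
      "\<And>n. norm (h n) \<le> indicator (A' k) n + 2 * real (c n) powr ?\<theta>"
      "(\<Sum>n\<in>block p k. c n) \<le> card (A' k)" "card (A' k) \<le> 2 * e"
      "norm ((\<Sum>n\<in>block p k. h n * f n) - of_nat e) \<le> real (card (A' k)) / 4"
      "\<And>m. norm (\<Sum>n\<in>block p k \<inter> {..<m}. h n * of_real (block_weight p k n))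
        \<le> 3 * real (card (A' k)) powr ?\<theta>"
    have "good k h c e"
      unfolding good_def by (intro conjI allI impI *)
    then show "\<exists>h c e. good k h c e"
      by (intro exI)
  qed (use f_le f_A in \<open>auto simp: A'_def\<close>)
  then obtain h c e where good: "\<And>k. good k (h k) (c k) (e k)"
    by metis
  have
    h_0: "\<And>k n. n \<notin> block p k \<Longrightarrow> h k n = 0" and
    h_le: "\<And>k n. norm (h k n) \<le> indicator (A' k) n + 2 * real (c k n) powr ?\<theta>" and
    c_le: "\<And>k. (\<Sum>n\<in>block p k. c k n) \<le> card (A' k)" and
    e_ge: "\<And>k. card (A' k) \<le> 2 * e k" and
    e_le: "\<And>k. norm ((\<Sum>n\<in>block p k. h k n * f n) - of_nat (e k)) \<le> real (card (A' k)) / 4" and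
    test: "\<And>k m. norm (\<Sum>n\<in>block p k \<inter> {..<m}. h k n * of_real (block_weight p k n))
        \<le> 3 * real (card (A' k)) powr ?\<theta>"
    using good unfolding good_def by blast+
  define U where "U = (\<Union>k<N. block p k)"
  define g where "g n = (\<Sum>k<N. h k n) + (if n \<in> A - U then inverse (f n) else 0)" for n
  define C where "C n = (\<Sum>k<N. if n \<in> block p k then c k n else 0)" for n
  have fin_U: "finite U"
    using finite_block[OF p] by (simp add: U_def)
  have A'_empty: "A' k = {}" if "\<not> k < N" for k
  proof -
    have "n \<le> k" if "n \<in> A" for n
      using Max_ge[OF A that] \<open>\<not> k < N\<close> by (simp add: N_def)
    then show ?thesis
      using block_gt[OF p] by (fastforce simp: A'_def)
  qed
  have g_block: "g n = h k n" and C_block: "C n = c k n" if "k < N" "n \<in> block p k" for k n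
  proof -
    have "n \<notin> block p j" if "j \<noteq> k" for j
      using block_unique[OF p \<open>n \<in> block p k\<close>, of j] that by blast
    moreover have "n \<in> U"
      using that by (auto simp: U_def)
    ultimately show "g n = h k n" "C n = c k n"
      using that by (simp_all add: g_def C_def sum_lessThan_single[OF \<open>k < N\<close>] h_0)
  qed
  have g_outside: "g n = (if n \<in> A then inverse (f n) else 0)" if "n \<notin> U" for n
    using that h_0 by (auto simp: g_def U_def intro!: sum.neutral)
  have card_le: "card (A' k) \<le> M" for k
    unfolding M_def A'_def using A by (intro card_mono) auto
  have sum_card: "(\<Sum>k<N. card (A' k)) = card (A \<inter> U)"
  proof -
    have "(\<Sum>k<N. card (A' k)) = card (\<Union>k<N. A' k)"
      using A block_unique[OF p] by (intro card_UN_disjoint[symmetric]) (auto simp: A'_def)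
    also have "(\<Union>k<N. A' k) = A \<inter> U"
      by (auto simp: A'_def U_def)
    finally show ?thesis .
  qed
  have g_le: "norm (g n) \<le> indicator A n + 2 * real (C n) powr ?\<theta>" for n
  proof (cases "n \<in> U")
    case True
    then obtain k where "k < N" "n \<in> block p k"
      by (auto simp: U_def)
    moreover have "indicator (A' k) n \<le> (indicator A n :: real)"
      by (auto simp: indicator_def A'_def)
    ultimately show ?thesis
      using h_le[of k n] by (simp add: g_block C_block)
  next
    case False
    then show ?thesis
      using f_A[of n] by (simp add: g_outside norm_inverse)
  qed
  have C_le: "(\<Sum>n\<in>B. C n) \<le> M" if "finite B" for B
  proof -
    have "(\<Sum>n\<in>B. C n) = (\<Sum>k<N. \<Sum>n\<in>B. if n \<in> block p k then c k n else 0)"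
      unfolding C_def by (rule sum.swap)
    also have "\<dots> = (\<Sum>k<N. \<Sum>n\<in>B \<inter> block p k. c k n)"
      using that by (simp add: sum.inter_restrict)
    also have "\<dots> \<le> (\<Sum>k<N. card (A' k))"
      using finite_block[OF p] by (intro sum_mono order_trans[OF _ c_le] sum_mono2) auto
    also have "\<dots> \<le> M"
      unfolding sum_card M_def using A by (intro card_mono) auto
    finally show ?thesis .
  qed
  have M_pos: "0 < real M powr ?\<theta>"
    using M by simp
  \<comment> \<open>The \<open>5\<close> is \<open>1\<close> from the indicator of \<open>A\<close>
    plus \<open>2 * 2\<close>, from the coefficient of the \<open>C n\<close> term and from
    \<open>sum_powr_le\<close>. It also covers the \<open>3\<close> from the weight test.\<close>
  define \<kappa> where "\<kappa> = inverse (5 * real M powr ?\<theta>)"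
  have \<kappa>: "0 < \<kappa>" "5 * real M powr ?\<theta> * \<kappa> = 1"
    using M_pos by (simp_all add: \<kappa>_def)
  have \<kappa>_mult: "\<kappa> * x \<le> y" if "x \<le> 5 * real M powr ?\<theta> * y" for x y
  proof -
    have "\<kappa> * x \<le> \<kappa> * (5 * real M powr ?\<theta> * y)"
      using that \<kappa>(1) by (intro mult_left_mono) auto
    also have "\<dots> = (5 * real M powr ?\<theta> * \<kappa>) * y"
      by (simp only: ac_simps)
    finally show ?thesis
      by (simp only: \<kappa>(2) mult_1)
  qed
  define F where "F n = of_real (\<kappa>) * g n" for n
  have "F \<in> dual_ball p"
    unfolding dual_ball_def
  proof (intro CollectI conjI allI impI)
    fix B :: "nat set" assume B: "finite B"
    \<comment> \<open>Of the two factors, one is compared with \<open>card A\<close> and the other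
      with \<open>card B\<close>.\<close>
    have "real (card (A \<inter> B)) = real (card (A \<inter> B)) powr ?\<theta> * real (card (A \<inter> B)) powr (1 / p)"
      by (rule of_nat_eq_powr_mult)
    also have "\<dots> \<le> real M powr ?\<theta> * real (card B) powr (1 / p)"
      unfolding M_def using p A B by (intro mult_mono powr_mono2 of_nat_mono card_mono) auto
    finally have "real (card (A \<inter> B)) \<le> real M powr ?\<theta> * real (card B) powr (1 / p)" .
    moreover have "(\<Sum>n\<in>B. real (C n) powr ?\<theta>) \<le> 2 * (real M powr ?\<theta> * real (card B) powr (1 / p))"
      using M C_le[OF B] by (intro sum_powr_le[OF p B]) (simp_all flip: of_nat_sum)
    moreover have "(\<Sum>n\<in>B. norm (g n)) \<le> (\<Sum>n\<in>B. indicator A n + 2 * real (C n) powr ?\<theta>)"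
      by (intro sum_mono g_le)
    moreover have "(\<Sum>n\<in>B. indicator A n) = real (card (A \<inter> B))"
      using sum.inter_restrict[OF B, of "\<lambda>_. 1::real" A] by (simp add: indicator_def of_bool_def Int_commute)
    ultimately have "(\<Sum>n\<in>B. norm (g n)) \<le> 5 * real M powr ?\<theta> * real (card B) powr (1 / p)"
      by (simp add: sum.distrib flip: sum_distrib_left)
    then have "\<kappa> * (\<Sum>n\<in>B. norm (g n)) \<le> real (card B) powr (1 / p)"
      by (rule \<kappa>_mult)
    then show "(\<Sum>n\<in>B. norm (F n)) \<le> real (card B) powr (1 / p)"
      using \<kappa>(1) by (simp add: F_def norm_mult sum_distrib_left)
  next
    fix k m
    let ?S = "\<Sum>n\<in>block p k \<inter> {..<m}. g n * of_real (block_weight p k n)"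
    have "norm ?S \<le> 5 * real M powr ?\<theta>"
    proof (cases "k < N")
      case True
      have "?S = (\<Sum>n\<in>block p k \<inter> {..<m}. h k n * of_real (block_weight p k n))"
        using True by (intro sum.cong) (auto simp: g_block)
      then have "norm ?S \<le> 3 * real (card (A' k)) powr ?\<theta>"
        using test[of k m] by simp
      moreover have "real (card (A' k)) powr ?\<theta> \<le> real M powr ?\<theta>"
        using p card_le[of k] by (intro powr_mono2) auto
      ultimately show ?thesis
        using M_pos by linarith
    next
      case False
      have "g n = 0" if "n \<in> block p k" for n
      proof -
        have "n \<notin> U"
          using block_unique[OF p that] False by (auto simp: U_def)
        moreover have "n \<notin> A"
          using A'_empty[OF False] that by (auto simp: A'_def)
        ultimately show ?thesis
          by (simp add: g_outside)
      qed
      then show ?thesis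
        by simp
    qed
    then have "\<kappa> * norm ?S \<le> 1"
      by (intro \<kappa>_mult) simp
    moreover have "(\<Sum>n\<in>block p k \<inter> {..<m}. F n * of_real (block_weight p k n))
        = of_real (\<kappa>) * ?S"
      by (simp add: F_def sum_distrib_left mult.assoc)
    ultimately show "norm (\<Sum>n\<in>block p k \<inter> {..<m}. F n * of_real (block_weight p k n)) \<le> 1"
      using \<kappa>(1) by (simp add: norm_mult)
  qed
  moreover
  \<comment> \<open>Beyond the support of \<open>g\<close>, so that the partial pairing is the full
    one.\<close>
  define m where "m = Suc (Max (A \<union> U))"
  have lt_m: "n < m" if "n \<in> A \<union> U" for n
    using Max_ge[OF _ that] A fin_U by (simp add: m_def)
  have "real M powr (1 / p) \<le> 20 * norm (pairing m F f)"
  proof -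
    have inv: "inverse (f n) * f n = 1" if "n \<in> A" for n
    proof -
      have "f n \<noteq> 0"
        using f_A[OF that] by auto
      then show ?thesis
        by simp
    qed
    \<comment> \<open>\<open>E\<close> is the main term of the pairing with \<open>g\<close>. It is
      at least \<open>M / 2\<close> and the error is at most \<open>M / 4\<close>, so the pairing
      has modulus at least \<open>M / 4\<close>; the scaling by \<open>\<kappa>\<close> turns the
      resulting \<open>4\<close> into \<open>20\<close>.\<close>
    define E where "E = (\<Sum>k<N. e k) + card (A - U)"
    have "pairing m g f = (\<Sum>n<m. \<Sum>k<N. h k n * f n) + (\<Sum>n<m. if n \<in> A - U then 1 else 0)"
      unfolding pairing_def g_def using inv
      by (auto simp: sum_distrib_right distrib_right sum.distrib intro!: sum.cong)
    also have "(\<Sum>n<m. if n \<in> A - U then 1 else 0 :: 'f) = of_nat (card (A - U))"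
    proof -
      have "(\<Sum>n<m. if n \<in> A - U then 1 else 0 :: 'f) = (\<Sum>n\<in>{..<m} \<inter> (A - U). 1)"
        by (subst sum.inter_restrict) simp_all
      also have "{..<m} \<inter> (A - U) = A - U"
        using lt_m by auto
      finally show ?thesis
        by simp
    qed
    also have "(\<Sum>n<m. \<Sum>k<N. h k n * f n) = (\<Sum>k<N. \<Sum>n<m. h k n * f n)"
      by (rule sum.swap)
    also have "\<dots> = (\<Sum>k<N. \<Sum>n\<in>block p k. h k n * f n)"
    proof (rule sum.cong)
      fix k assume "k \<in> {..<N}"
      then have "block p k \<subseteq> {..<m}"
        using lt_m by (auto simp: U_def)
      then show "(\<Sum>n<m. h k n * f n) = (\<Sum>n\<in>block p k. h k n * f n)"
        using h_0 by (intro sum.mono_neutral_right) auto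
    qed simp
    finally have "pairing m g f - of_nat E = (\<Sum>k<N. (\<Sum>n\<in>block p k. h k n * f n) - of_nat (e k))"
      by (simp add: E_def sum_subtractf)
    also have "norm \<dots> \<le> (\<Sum>k<N. real (card (A' k)) / 4)"
      by (intro sum_norm_le e_le)
    also have "\<dots> = real (\<Sum>k<N. card (A' k)) / 4"
      by (simp add: sum_divide_distrib)
    also have "\<dots> \<le> real M / 4"
      unfolding sum_card M_def using A by (intro divide_right_mono of_nat_mono card_mono) auto
    finally have close: "norm (pairing m g f - of_nat E) \<le> real M / 4" .
    have "M = card (A \<inter> U) + card (A - U)"
      unfolding M_def using A by (subst card_Un_disjoint[symmetric]) (auto simp: Un_Diff_Int Un_commute)
    also have "card (A \<inter> U) \<le> 2 * (\<Sum>k<N. e k)"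
      unfolding sum_card[symmetric] sum_distrib_left by (intro sum_mono e_ge)
    finally have "M \<le> 2 * E"
      by (simp add: E_def)
    then have "real M \<le> 2 * real E"
      by linarith
    moreover have "real E \<le> norm (pairing m g f) + norm (pairing m g f - of_nat E)"
      using norm_triangle_ineq4[of "pairing m g f" "pairing m g f - of_nat E"] by simp
    ultimately have "real M \<le> 4 * norm (pairing m g f)"
      using close by linarith
    moreover have "pairing m F f = of_real (\<kappa>) * pairing m g f"
      by (simp add: pairing_def F_def sum_distrib_left mult.assoc)
    then have "norm (pairing m F f) = \<kappa> * norm (pairing m g f)"
      using \<kappa>(1) by (simp add: norm_mult)
    then have "5 * real M powr ?\<theta> * norm (pairing m F f) = norm (pairing m g f)"
      using \<kappa>(2) by (simp only: mult.assoc[symmetric] mult_1)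
    ultimately have "real M \<le> real M powr ?\<theta> * (20 * norm (pairing m F f))"
      by linarith
    then have "real M powr ?\<theta> * real M powr (1 / p) \<le> real M powr ?\<theta> * (20 * norm (pairing m F f))"
      by (simp only: of_nat_eq_powr_mult[symmetric])
    then show ?thesis
      using M_pos by (simp only: mult_le_cancel_left_pos)
  qed
  ultimately show ?thesis
    using that by (simp add: M_def)
qed

section \<open>Verification of the properties of the basis\<close>

lemma basis_of_type_p:
  fixes p :: real
  assumes p: "1 \<le> p"
  shows "\<exists>(X :: (nat \<Rightarrow> 'f::{real_normed_field,banach}) set) nrm x coord.
      schauder_basis seq_scale X nrm x coord \<and>
      basis.monotone_basis seq_scale X nrm x coord \<and>
      basis.qglc seq_scale X nrm x coord \<and>
      basis.democratic seq_scale nrm x \<and>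
      basis.super_democratic seq_scale nrm x \<and>
      \<not> basis.lucc seq_scale nrm x \<and>
      (\<exists>C\<ge>1. \<forall>m\<ge>1.
         inverse C * real m powr (1 / p) \<le> basis.fundamental_function seq_scale nrm x m \<and>
         basis.fundamental_function seq_scale nrm x m \<le> C * real m powr (1 / p))"
proof -
  interpret N: norming_set "dual_ball p :: (nat \<Rightarrow> 'f) set"
    by (rule norming_dual_ball[OF p])
  have lower: "real (card A) powr (1 / p) \<le> 20 * N.nrm f"
    if f: "f \<in> N.X" and *: "\<And>n. norm (f n) \<le> 1" "finite A" "\<And>n. n \<in> A \<Longrightarrow> norm (f n) = 1" for f A
  proof -
    obtain h m where "h \<in> dual_ball p" and le: "real (card A) powr (1 / p) \<le> 20 * norm (pairing m h f)"
      using dual_ball_witness[OF p *] .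
    then have "norm (pairing m h f) \<le> N.nrm f"
      by (intro N.pairing_le_nrm[OF N.bounds_X[OF f]])
    with le show ?thesis
      by linarith
  qed
  have upper: "N.nrm (\<lambda>n. if n \<in> A then u n else 0) \<le> real (card A) powr (1 / p)"
    if A: "finite A" and u: "\<And>n. n \<in> A \<Longrightarrow> norm (u n) \<le> 1" for A and u :: "nat \<Rightarrow> 'f"
  proof (rule N.nrm_le, unfold N.bounds_def, intro ballI allI)
    fix h m assume h: "h \<in> (dual_ball p :: (nat \<Rightarrow> 'f) set)"
    have "norm (\<Sum>n\<in>A \<inter> {..<m}. h n * u n) \<le> real (card (A \<inter> {..<m})) powr (1 / p)"
      using A u by (intro dual_ball_sum_le[OF p h]) auto
    also have "\<dots> \<le> real (card A) powr (1 / p)"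
      using A p by (intro powr_mono2 of_nat_mono card_mono) auto
    finally show "norm (pairing m h (\<lambda>n. if n \<in> A then u n else 0)) \<le> real (card A) powr (1 / p)"
      by (simp only: pairing_seq_sum[OF A])
  qed
  have ind_upper: "N.nrm (N.B.indicator_sum \<epsilon> A) \<le> real (card A) powr (1 / p)"
    if "finite A" "N.B.unimodular_on A \<epsilon>" for A \<epsilon>
    using upper[OF that(1), of \<epsilon>] that by (simp add: N.indicator_sum_eq N.B.unimodular_on_def)
  have ind_lower: "real (card A) powr (1 / p) \<le> 20 * N.nrm (N.B.indicator_sum \<epsilon> A)"
    if "finite A" "N.B.unimodular_on A \<epsilon>" for A \<epsilon>
    using that by (intro lower N.B.indicator_sum_in_X)
      (auto simp: N.indicator_sum_eq N.B.unimodular_on_def)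
  have super: "N.B.super_democratic"
    unfolding N.B.super_democratic_def
  proof (intro exI[of _ 20] allI impI, elim conjE)
    fix A B :: "nat set" and \<epsilon> \<delta> :: "nat \<Rightarrow> 'f"
    assume *: "finite A" "finite B" "card A \<le> card B"
      "N.B.unimodular_on A \<epsilon>" "N.B.unimodular_on B \<delta>"
    have "N.nrm (N.B.indicator_sum \<epsilon> A) \<le> real (card A) powr (1 / p)"
      using * by (intro ind_upper)
    also have "\<dots> \<le> real (card B) powr (1 / p)"
      using * p by (intro powr_mono2) auto
    also have "\<dots> \<le> 20 * N.nrm (N.B.indicator_sum \<delta> B)"
      using * by (intro ind_lower)
    finally show "N.nrm (N.B.indicator_sum \<epsilon> A) \<le> 20 * N.nrm (N.B.indicator_sum \<delta> B)" .
  qed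
  have demo: "N.B.democratic"
  proof -
    have one: "N.B.unimodular_on A (\<lambda>_. 1)" for A
      by (simp add: N.B.unimodular_on_def)
    from super obtain C where C: "\<And>A B \<epsilon> \<delta>. finite A \<and> finite B \<and> card A \<le> card B \<and>
       N.B.unimodular_on A \<epsilon> \<and> N.B.unimodular_on B \<delta> \<Longrightarrow>
       N.nrm (N.B.indicator_sum \<epsilon> A) \<le> C * N.nrm (N.B.indicator_sum \<delta> B)"
      unfolding N.B.super_democratic_def by blast
    show ?thesis
      unfolding N.B.democratic_def
      by (intro exI[of _ C] allI impI C) (simp add: one)
  qed
  have qglc: "N.B.qglc"
    unfolding N.B.qglc_def
  proof (intro exI[of _ 20] ballI allI impI, elim conjE)
    fix f A assume f: "f \<in> N.X" and "N.B.greedy_set f A" and "A \<noteq> {}"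
      and osc: "N.B.oscillation f A = 1"
    then have A: "finite A" and greedy: "\<And>n k. n \<in> A \<Longrightarrow> k \<notin> A \<Longrightarrow> norm (f k) \<le> norm (f n)"
      by (auto simp: N.B.greedy_set_def)
    define t where "t = Max ((\<lambda>n. norm (f n)) ` A)"
    define s where "s = Min ((\<lambda>n. norm (f n)) ` A)"
    \<comment> \<open>Oscillation \<open>1\<close> forces equal maximum and minimum, the convention
      \<open>0 / 0 = 1\<close> included.\<close>
    have "t = s"
      using osc unfolding N.B.oscillation_def t_def[symmetric] s_def[symmetric] Let_def
      by (auto split: if_splits)
    have f_A: "norm (f n) = t" if "n \<in> A" for n
    proof (rule antisym)
      show "norm (f n) \<le> t"
        unfolding t_def using A that by (intro Max_ge) auto
      show "t \<le> norm (f n)"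
        unfolding \<open>t = s\<close> s_def using A that by (intro Min_le) auto
    qed
    obtain a where "a \<in> A"
      using \<open>A \<noteq> {}\<close> by blast
    have f_le: "norm (f n) \<le> t" for n
      using f_A f_A[OF \<open>a \<in> A\<close>] greedy[OF \<open>a \<in> A\<close>] by (cases "n \<in> A") auto
    have "0 \<le> t"
      using order_trans[OF norm_ge_zero f_le] .
    show "N.nrm (N.B.coord_projection A f) \<le> 20 * N.nrm f"
    proof (cases "t = 0")
      case True
      then have "N.B.coord_projection A f = 0"
        using f_A by (auto simp: N.coord_projection_eq[OF A] fun_eq_iff)
      then show ?thesis
        using N.nrm_zero N.nrm_ge_0[of f] by simp
    next
      case False
      then have t: "0 < t"
        using \<open>0 \<le> t\<close> by simp
      \<comment> \<open>Scaling makes the coefficients on \<open>A\<close> unimodular and keeps the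
        others at modulus at most \<open>1\<close>, so \<open>upper\<close> and \<open>lower\<close>
        meet at \<open>card A powr (1 / p)\<close>.\<close>
      define g where "g = seq_scale (of_real (inverse t)) f"
      have norm_g: "norm (g n) = norm (f n) / t" for n
        using t by (simp add: g_def seq_scale_def norm_mult norm_inverse divide_inverse)
      have fg: "f = seq_scale (of_real t) g"
        using t by (simp add: g_def seq_scale_def fun_eq_iff)
      have g: "g \<in> N.X"
        unfolding g_def by (rule N.X_scale[OF f])
      have "N.B.coord_projection A f = seq_scale (of_real t) (\<lambda>n. if n \<in> A then g n else 0)"
        unfolding fg by (auto simp: N.coord_projection_eq[OF A] seq_scale_def fun_eq_iff)
      then have "N.nrm (N.B.coord_projection A f) = t * N.nrm (\<lambda>n. if n \<in> A then g n else 0)"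
        using N.nrm_seq_scale[OF N.bounds_X[OF N.finite_sum_X[OF A]]] t by simp
      also have "\<dots> \<le> t * real (card A) powr (1 / p)"
        using t f_le by (intro mult_left_mono upper[OF A]) (auto simp: norm_g)
      also have "\<dots> \<le> t * (20 * N.nrm g)"
        using t f_le f_A by (intro mult_left_mono lower[OF g _ A]) (auto simp: norm_g)
      also have "\<dots> = 20 * N.nrm f"
        unfolding fg using N.nrm_seq_scale[OF N.bounds_X[OF g]] t by simp
      finally show ?thesis .
    qed
  qed
  have not_lucc: "\<not> N.B.lucc"
  proof
    assume "N.B.lucc"
    then obtain C where C: "\<And>A a b. finite A \<and> N.B.unimodular_on A b \<and>
       (\<forall>n\<in>A. \<exists>t\<ge>1. a n / b n = of_real t) \<Longrightarrow>
       N.nrm (\<Sum>n\<in>A. seq_scale (b n) (unit_seq n)) \<le> C * N.nrm (\<Sum>n\<in>A. seq_scale (a n) (unit_seq n))"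
      unfolding N.B.lucc_def by blast
    \<comment> \<open>The block indicator has norm at least \<open>(2 * ?q) ^ k / 20\<close> and its
      competitor at most \<open>?q ^ k\<close>, so \<open>2 ^ k / 20\<close> has to exceed
      \<open>C\<close>, whose sign is unknown.\<close>
    obtain k where k: "20 * \<bar>C\<bar> < 2 ^ k"
      using real_arch_pow[of 2] by auto
    interpret tree "radix p k" k p "ratio p k"
      by (rule tree_radix[OF p])
    let ?q = "ratio p k"
    \<comment> \<open>The weights multiplied by \<open>?q ^ k\<close>: leaves get the coefficient
      \<open>1\<close>, and all coefficients are real and at least \<open>1\<close>, as LUCC demands
      with \<open>b\<close> constantly \<open>1\<close>.\<close>
    define a :: "nat \<Rightarrow> 'f" where "a n = of_real (?q ^ multiplicity (radix p k) n)" for n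
    have one: "N.B.unimodular_on T (\<lambda>_. 1)"
      by (simp add: N.B.unimodular_on_def)
    have "(2 * ?q) ^ k = real (card T) powr (1 / p)"
      by (rule card_block_powr[OF p, symmetric])
    also have "\<dots> \<le> 20 * N.nrm (N.B.indicator_sum (\<lambda>_. 1) T)"
      by (rule ind_lower[OF finite_T one])
    also have "N.nrm (N.B.indicator_sum (\<lambda>_. 1) T) \<le> C * N.nrm (\<Sum>n\<in>T. seq_scale (a n) (unit_seq n))"
      unfolding N.B.indicator_sum_def
    proof (rule C, intro conjI ballI)
      fix n
      show "\<exists>t\<ge>1. a n / 1 = of_real t"
        using q_ge_4 by (intro exI[of _ "?q ^ multiplicity (radix p k) n"]) (simp add: a_def)
    qed (fact finite_T, fact one)
    also have "\<dots> \<le> \<bar>C\<bar> * ?q ^ k"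
    proof (intro mult_mono)
      show "N.nrm (\<Sum>n\<in>T. seq_scale (a n) (unit_seq n)) \<le> ?q ^ k"
        unfolding sum_scale_unit_seq[OF finite_T]
      proof (rule N.nrm_le, unfold N.bounds_def, intro ballI allI)
        fix h m assume h: "h \<in> (dual_ball p :: (nat \<Rightarrow> 'f) set)"
        have "h n * a n = of_real (?q ^ k) * (h n * of_real (weight n))" for n
          using q_ge_4 by (simp add: a_def weight_def)
        then have "pairing m h (\<lambda>n. if n \<in> T then a n else 0)
            = of_real (?q ^ k) * (\<Sum>n\<in>T \<inter> {..<m}. h n * of_real (weight n))"
          by (simp only: pairing_seq_sum[OF finite_T] sum_distrib_left)
        then have "norm (pairing m h (\<lambda>n. if n \<in> T then a n else 0))
            = ?q ^ k * norm (\<Sum>n\<in>T \<inter> {..<m}. h n * of_real (weight n))"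
          using q_ge_4 by (simp only: norm_mult norm_of_real) simp
        also have "\<dots> \<le> ?q ^ k * 1"
          using h q_ge_4 unfolding dual_ball_def by (intro mult_left_mono) auto
        finally show "norm (pairing m h (\<lambda>n. if n \<in> T then a n else 0)) \<le> ?q ^ k"
          by simp
      qed
    qed (use N.nrm_ge_0 in auto)
    finally have "2 ^ k * ?q ^ k \<le> 20 * \<bar>C\<bar> * ?q ^ k"
      by (simp add: power_mult_distrib)
    then show False
      using k q_ge_4 by simp
  qed
  have fund: "\<exists>C\<ge>1. \<forall>m\<ge>1.
       inverse C * real m powr (1 / p) \<le> N.B.fundamental_function m \<and>
       N.B.fundamental_function m \<le> C * real m powr (1 / p)"
  proof (intro exI[of _ 20] conjI allI impI)
    fix m :: nat
    have one: "N.B.unimodular_on {..<m} (\<lambda>_. 1)"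
      by (simp add: N.B.unimodular_on_def)
    have "N.nrm (N.B.indicator_sum (\<lambda>_. 1) {..<m}) \<le> N.B.fundamental_function m"
      unfolding N.B.fundamental_function_def
    proof (intro cSup_upper N.B.bdd_above_fundamental_values)
      show "N.nrm (N.B.indicator_sum (\<lambda>_. 1) {..<m}) \<in> N.B.fundamental_values m"
        unfolding N.B.fundamental_values_def using one
        by (intro CollectI exI[of _ "\<lambda>_. 1"] exI[of _ "{..<m}"]) simp
    qed
    then show "inverse 20 * real m powr (1 / p) \<le> N.B.fundamental_function m"
      using ind_lower[OF _ one] by simp
    have "N.B.fundamental_function m \<le> real m powr (1 / p)"
      unfolding N.B.fundamental_function_def
    proof (intro cSup_least N.B.fundamental_values_nonempty)
      fix v assume "v \<in> N.B.fundamental_values m"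
      then obtain \<epsilon> A where v: "v = N.nrm (N.B.indicator_sum \<epsilon> A)"
        and A: "finite A" "card A \<le> m" "N.B.unimodular_on A \<epsilon>"
        unfolding N.B.fundamental_values_def by blast
      have "v \<le> real (card A) powr (1 / p)"
        unfolding v using A by (intro ind_upper)
      also have "\<dots> \<le> real m powr (1 / p)"
        using A p by (intro powr_mono2) auto
      finally show "v \<le> real m powr (1 / p)" .
    qed
    also have "\<dots> \<le> 20 * real m powr (1 / p)"
      by simp
    finally show "N.B.fundamental_function m \<le> 20 * real m powr (1 / p)" .
  qed simp
  show ?thesis
    by (intro exI[of _ N.X] exI[of _ N.nrm] exI[of _ unit_seq] exI[of _ "\<lambda>n f. f n"] conjI
        N.schauder_basis_X N.monotone_basis_X qglc demo super not_lucc fund)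
qed

theorem theorem4p5:
  shows "(\<exists>(X :: (nat \<Rightarrow> real) set) nrm x coord.
      schauder_basis seq_scale X nrm x coord \<and>
      basis.monotone_basis seq_scale X nrm x coord \<and>
      basis.qglc seq_scale X nrm x coord \<and>
      basis.democratic seq_scale nrm x \<and>
      basis.super_democratic seq_scale nrm x \<and>
      \<not> basis.lucc seq_scale nrm x) \<and>
    (\<forall>p::real. 1 \<le> p \<longrightarrow>
      (\<exists>(X :: (nat \<Rightarrow> real) set) nrm x coord.
        schauder_basis seq_scale X nrm x coord \<and>
        basis.monotone_basis seq_scale X nrm x coord \<and>
        basis.qglc seq_scale X nrm x coord \<and>
        basis.democratic seq_scale nrm x \<and>
        basis.super_democratic seq_scale nrm x \<and>
        \<not> basis.lucc seq_scale nrm x \<and>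
        (\<exists>C\<ge>1. \<forall>m\<ge>1.
           inverse C * real m powr (1 / p) \<le> basis.fundamental_function seq_scale nrm x m \<and>
           basis.fundamental_function seq_scale nrm x m \<le> C * real m powr (1 / p)))) \<and>
    (\<exists>(X :: (nat \<Rightarrow> complex) set) nrm x coord.
      schauder_basis seq_scale X nrm x coord \<and>
      basis.monotone_basis seq_scale X nrm x coord \<and>
      basis.qglc seq_scale X nrm x coord \<and>
      basis.democratic seq_scale nrm x \<and>
      basis.super_democratic seq_scale nrm x \<and>
      \<not> basis.lucc seq_scale nrm x) \<and>
    (\<forall>p::real. 1 \<le> p \<longrightarrow>
      (\<exists>(X :: (nat \<Rightarrow> complex) set) nrm x coord.
        schauder_basis seq_scale X nrm x coord \<and>
        basis.monotone_basis seq_scale X nrm x coord \<and>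
        basis.qglc seq_scale X nrm x coord \<and>
        basis.democratic seq_scale nrm x \<and>
        basis.super_democratic seq_scale nrm x \<and>
        \<not> basis.lucc seq_scale nrm x \<and>
        (\<exists>C\<ge>1. \<forall>m\<ge>1.
           inverse C * real m powr (1 / p) \<le> basis.fundamental_function seq_scale nrm x m \<and>
           basis.fundamental_function seq_scale nrm x m \<le> C * real m powr (1 / p))))"
proof (intro conjI allI impI)
  \<comment> \<open>Here \<open>order_refl\<close> specialises the exponent to \<open>p = 1\<close>,
    and the clause on the fundamental function is dropped.\<close>
  show "\<exists>(X :: (nat \<Rightarrow> real) set) nrm x coord.
      schauder_basis seq_scale X nrm x coord \<and>
      basis.monotone_basis seq_scale X nrm x coord \<and>
      basis.qglc seq_scale X nrm x coord \<and>
      basis.democratic seq_scale nrm x \<and>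
      basis.super_democratic seq_scale nrm x \<and>
      \<not> basis.lucc seq_scale nrm x"
    using basis_of_type_p[where 'f = real, OF order_refl] by (elim ex_forward) blast
  show "\<exists>(X :: (nat \<Rightarrow> complex) set) nrm x coord.
      schauder_basis seq_scale X nrm x coord \<and>
      basis.monotone_basis seq_scale X nrm x coord \<and>
      basis.qglc seq_scale X nrm x coord \<and>
      basis.democratic seq_scale nrm x \<and>
      basis.super_democratic seq_scale nrm x \<and>
      \<not> basis.lucc seq_scale nrm x"
    using basis_of_type_p[where 'f = complex, OF order_refl] by (elim ex_forward) blast
qed (rule basis_of_type_p, assumption)+

end
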